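(* Let $(V,\nu,\tau,\tau^* )$ be a PN space such that $\tau^*$ is Archimedean and $\nu_p\neq\varepsilon_\infty$ for every $p\in V$, and let $\{p_1,\dots,p_n\}$ be a linearly independent set of vectors in $V$. Then there exist a number $c\neq0$ and a probabilistic norm $\nu':\mathbb{R}\to\Delta^+$ on a real PN space $(\mathbb{R},\nu',\tau',\tau'^{*})$, where $\tau'^{*}$ is Archimedean and $\nu'_p\neq\varepsilon_\infty$ for all $p\in\mathbb{R}$, such that for every choice of real scalars $\alpha_1,\dots,\alpha_n$, $$\nu_{\alpha_1p_1+\cdots+\alpha_np_n}\le\nu'_{c(|\alpha_1|+\cdots+|\alpha_n|)}.$$
   Context: $\Delta^{+}$ is the set of functions $F:[-\infty,+\infty]\to[0,1]$ that are left-continuous on $\mathbb{R}$, nondecreasing, with $F(0)=0$ and $F(+\infty)=1$, ordered pointwise ($F\le G$ iff $F(x)\le G(x)$ for all $x$). $\varepsilon_0$ is the d.f. equal to $0$ for $x\le0$ and $1$ for $x>0$; $\varepsilon_\infty$ is the d.f. equal to $0$ on all of $\mathbb{R}$ (and $1$ at $+\infty$). A triangle function is a map $\tau:\Delta^+\times\Delta^+\to\Delta^+$ that is associative, commutative, nondecreasing in each argument, with unit $\varepsilon_0$; it is Archimedean if its only idempotents (elements $F$ with $\tau(F,F)=F$) are $\varepsilon_0$ and $\varepsilon_\infty$. A PN space is a quadruple $(V,\nu,\tau,\tau^* )$ with $V$ a real vector space, $\tau\le\tau^*$ continuous triangle functions, and $\nu:V\to\Delta^+$ such that for all $p,q\in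 V$: (N1) $\nu_p=\varepsilon_0$ iff $p=\theta$; (N2) $\nu_{-p}=\nu_p$; (N3) $\nu_{p+q}\ge\tau(\nu_p,\nu_q)$; (N4) $\nu_p\le\tau^*(\nu_{\lambda p},\nu_{(1-\lambda)p})$ for all $\lambda\in[0,1]$. *)

theory Defs
  imports Complex_Main "HOL-Library.Extended_Real"
begin

type_synonym df = "ereal \<Rightarrow> real"

definition DeltaPlus :: "df set" where
  "DeltaPlus = {F. (\<forall>x. 0 \<le> F x \<and> F x \<le> 1)
      \<and> (\<forall>x::real. ((\<lambda>y::real. F (ereal y)) \<longlongrightarrow> F (ereal x)) (at_left x))
      \<and> mono F \<and> F (ereal 0) = 0 \<and> F \<infinity> = 1}"

definition eps0 :: df where
  "eps0 x = (if x > 0 then 1 else 0)"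

definition epsInf :: df where
  "epsInf x = (if x = \<infinity> then 1 else 0)"

definition df_le :: "df \<Rightarrow> df \<Rightarrow> bool" where
  "df_le F G \<longleftrightarrow> (\<forall>x. F x \<le> G x)"

text \<open>Weak convergence in Delta+: convergence at every real continuity point of the limit.
  The topology of weak convergence on Delta+ is metrizable (modified Levy metric),
  so continuity can be expressed sequentially.\<close>
definition weak_conv :: "(nat \<Rightarrow> df) \<Rightarrow> df \<Rightarrow> bool" where
  "weak_conv Fs F \<longleftrightarrow> (\<forall>x::real. isCont (\<lambda>y::real. F (ereal y)) x
       \<longrightarrow> (\<lambda>n. Fs n (ereal x)) \<longlonglongrightarrow> F (ereal x))"

definition triangle_function :: "(df \<Rightarrow> df \<Rightarrow> df) \<Rightarrow> bool" where
  "triangle_function T \<longleftrightarrow>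
     (\<forall>F\<in>DeltaPlus. \<forall>G\<in>DeltaPlus. T F G \<in> DeltaPlus)
   \<and> (\<forall>F\<in>DeltaPlus. \<forall>G\<in>DeltaPlus. \<forall>H\<in>DeltaPlus. T (T F G) H = T F (T G H))
   \<and> (\<forall>F\<in>DeltaPlus. \<forall>G\<in>DeltaPlus. T F G = T G F)
   \<and> (\<forall>F\<in>DeltaPlus. \<forall>G\<in>DeltaPlus. \<forall>H\<in>DeltaPlus. df_le F G \<longrightarrow> df_le (T F H) (T G H))
   \<and> (\<forall>F\<in>DeltaPlus. T F eps0 = F)"

definition continuous_tf :: "(df \<Rightarrow> df \<Rightarrow> df) \<Rightarrow> bool" where
  "continuous_tf T \<longleftrightarrow> (\<forall>Fs F Gs G. (\<forall>n. Fs n \<in> DeltaPlus) \<longrightarrow> F \<in> DeltaPlus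
      \<longrightarrow> (\<forall>n. Gs n \<in> DeltaPlus) \<longrightarrow> G \<in> DeltaPlus
      \<longrightarrow> weak_conv Fs F \<longrightarrow> weak_conv Gs G
      \<longrightarrow> weak_conv (\<lambda>n. T (Fs n) (Gs n)) (T F G))"

definition archimedean_tf :: "(df \<Rightarrow> df \<Rightarrow> df) \<Rightarrow> bool" where
  "archimedean_tf T \<longleftrightarrow> (\<forall>F\<in>DeltaPlus. T F F = F \<longrightarrow> F = eps0 \<or> F = epsInf)"

definition PN_space :: "('v::real_vector \<Rightarrow> df) \<Rightarrow> (df \<Rightarrow> df \<Rightarrow> df) \<Rightarrow> (df \<Rightarrow> df \<Rightarrow> df) \<Rightarrow> bool" where
  "PN_space \<nu> T Ts \<longleftrightarrow>
     triangle_function T \<and> triangle_function Ts \<and> continuous_tf T \<and> continuous_tf Ts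
   \<and> (\<forall>F\<in>DeltaPlus. \<forall>G\<in>DeltaPlus. df_le (T F G) (Ts F G))
   \<and> (\<forall>p. \<nu> p \<in> DeltaPlus)
   \<and> (\<forall>p. \<nu> p = eps0 \<longleftrightarrow> p = 0)
   \<and> (\<forall>p. \<nu> (- p) = \<nu> p)
   \<and> (\<forall>p q. df_le (T (\<nu> p) (\<nu> q)) (\<nu> (p + q)))
   \<and> (\<forall>p. \<forall>l\<in>{0..1::real}. df_le (\<nu> p) (Ts (\<nu> (l *\<^sub>R p)) (\<nu> ((1 - l) *\<^sub>R p))))"

end

theory Submission
  imports Defs "HOL-Analysis.Analysis"
begin

text \<open>
  Let \<open>\<Phi> t x\<close> be the supremum of \<open>\<nu> (\<Sum>i<n. \<alpha> i *\<^sub>R p i) x\<close> over all \<open>\<alpha>\<close> with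
  \<open>(\<Sum>i<n. \<bar>\<alpha> i\<bar>) \<ge> t\<close>. Along a ray \<open>\<nu>\<close> is monotone and its limits at \<open>0\<close> and at infinity are
  idempotents of the Archimedean function \<open>Ts\<close>, hence equal \<open>eps0\<close> and \<open>epsInf\<close>. With compactness
  of the coefficient sphere this yields \<open>\<Phi> t x \<longlonglongrightarrow> 0\<close> as \<open>t\<close> grows, and for every \<open>t > 0\<close> some
  \<open>x > 0\<close> with \<open>\<Phi> t x < 1\<close>.

  On the real line, \<open>exp (- max 0 (\<bar>t\<bar> - x))\<close> is a probabilistic norm under the sup-convolution
  with respect to the product, which is Archimedean. Conjugating by increasing bijections \<open>\<eta>\<close> of the
  half-line and \<open>\<theta>\<close> of the unit interval keeps all properties, and the two facts about \<open>\<Phi>\<close> are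
  exactly what allows to choose \<open>\<theta>\<close> and \<open>\<eta>\<close> with
  \<open>\<Phi> t x \<le> \<theta> (exp (- max 0 (t - \<eta> x)))\<close>.
\<close>

subsection \<open>Distribution functions\<close>

text \<open>On \<open>DeltaPlus\<close> the values at both infinities are forced: 1 at the top by
  definition, 0 at the bottom by monotonicity and \<open>F 0 = 0\<close>. A member is thus given by
  its restriction to the reals.\<close>

definition df_of :: "(real \<Rightarrow> real) \<Rightarrow> df" where
  "df_of f x = (if x = \<infinity> then 1 else if x = -\<infinity> then 0 else f (real_of_ereal x))"

lemma df_of_simps [simp]:
  "df_of f (ereal x) = f x" "df_of f \<infinity> = 1" "df_of f (-\<infinity>) = 0"
  by (auto simp: df_of_def)

lemma DeltaPlusD:
  assumes "F \<in> DeltaPlus"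
  shows "0 \<le> F x" "F x \<le> 1" "mono F" "F 0 = 0" "F \<infinity> = 1"
  using assms unfolding DeltaPlus_def zero_ereal_def by auto

lemma DeltaPlus_mono:
  assumes "F \<in> DeltaPlus" "x \<le> y"
  shows "F (ereal x) \<le> F (ereal y)"
  using DeltaPlusD(3)[OF assms(1)] assms(2) by (auto simp: mono_def)

lemma DeltaPlus_nonpos:
  assumes "F \<in> DeltaPlus" "x \<le> 0"
  shows "F x = 0"
  using DeltaPlusD(3)[OF assms(1)] DeltaPlusD(1,4)[OF assms(1)] assms(2)
  by (metis antisym monoD)

text \<open>For nondecreasing functions left-continuity amounts to this approximation from below,
  which is the form later proofs use.\<close>

lemma DeltaPlus_left_approx:
  assumes "F \<in> DeltaPlus" "c < F (ereal x)"
  shows "\<exists>y<x. c < F (ereal y)"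
proof -
  have "((\<lambda>y::real. F (ereal y)) \<longlongrightarrow> F (ereal x)) (at_left x)"
    using assms(1) by (auto simp: DeltaPlus_def)
  then have "eventually (\<lambda>y. c < F (ereal y)) (at_left x)"
    using assms(2) by (rule order_tendstoD(1))
  moreover have "eventually (\<lambda>y. y < x) (at_left x)"
    by (simp add: eventually_at_filter)
  ultimately have "eventually (\<lambda>y. y < x \<and> c < F (ereal y)) (at_left x)"
    by eventually_elim simp
  then show ?thesis
    using eventually_happens[of _ "at_left x"] by (auto simp: trivial_limit_at_left_real)
qed

text \<open>By monotonicity only lower bounds have to be approximated from the left. The hypothesis
  \<open>left\<close> asks this for nonnegative \<open>c\<close> alone, since every value of
  \<open>f\<close> exceeds a negative \<open>c\<close>.\<close>

lemma df_of_in_DeltaPlus: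
  assumes bnd: "\<And>x. 0 \<le> f x" "\<And>x. f x \<le> 1" and mono: "\<And>x y. x \<le> y \<Longrightarrow> f x \<le> f y"
    and zero: "f 0 = 0" and left: "\<And>x c. c < f x \<Longrightarrow> 0 \<le> c \<Longrightarrow> \<exists>y<x. c < f y"
  shows "df_of f \<in> DeltaPlus"
proof -
  have 1: "0 \<le> df_of f x \<and> df_of f x \<le> 1" for x
    by (cases x) (auto simp: bnd)
  have 2: "df_of f x \<le> df_of f y" if "x \<le> y" for x y
    using that by (cases x; cases y) (auto simp: bnd mono)
  have 3: "(f \<longlongrightarrow> f x) (at_left x)" for x
  proof (rule order_tendstoI)
    fix c assume c: "c < f x"
    obtain y where y: "y < x" "c < f y"
    proof (cases "0 \<le> c")
      case True
      then show ?thesis using left[OF c] that by blast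
    next
      case False
      then show ?thesis using bnd(1)[of "x - 1"] that[of "x - 1"] by auto
    qed
    show "eventually (\<lambda>z. c < f z) (at_left x)"
      unfolding eventually_at_left_field
      using y mono by (meson less_le_trans less_imp_le)
  next
    fix c assume c: "f x < c"
    show "eventually (\<lambda>z. f z < c) (at_left x)"
      unfolding eventually_at_left_field
      using c mono by (metis le_less_trans less_imp_le lt_ex)
  qed
  show ?thesis unfolding DeltaPlus_def mono_def
    using 1 2 3 zero by simp
qed

lemma DeltaPlus_eqI:
  assumes "F \<in> DeltaPlus" "G \<in> DeltaPlus" "\<And>x. F (ereal x) = G (ereal x)"
  shows "F = G"
proof
  fix x show "F x = G x"
    using assms(3) DeltaPlusD(5)[OF assms(1)] DeltaPlusD(5)[OF assms(2)]
      DeltaPlus_nonpos[OF assms(1), of "-\<infinity>"] DeltaPlus_nonpos[OF assms(2), of "-\<infinity>"]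
    by (cases x) auto
qed

lemma df_le_DeltaPlusI:
  assumes "F \<in> DeltaPlus" "G \<in> DeltaPlus" "\<And>x. F (ereal x) \<le> G (ereal x)"
  shows "df_le F G"
  unfolding df_le_def
proof
  fix x show "F x \<le> G x"
    using assms(3) DeltaPlusD(5)[OF assms(1)] DeltaPlusD(5)[OF assms(2)]
      DeltaPlus_nonpos[OF assms(1), of "-\<infinity>"] DeltaPlus_nonpos[OF assms(2), of "-\<infinity>"]
    by (cases x) auto
qed

lemma df_le_antisym: "df_le F G \<Longrightarrow> df_le G F \<Longrightarrow> F = G"
  by (auto simp: df_le_def intro!: ext antisym)

lemma df_le_trans: "df_le F G \<Longrightarrow> df_le G H \<Longrightarrow> df_le F H"
  by (meson df_le_def order_trans)

lemma eps0_in_DeltaPlus [simp]: "eps0 \<in> DeltaPlus"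
proof -
  have "eps0 = df_of (\<lambda>x. if x > 0 then 1 else 0)"
    by (rule ext, rename_tac x, case_tac x) (auto simp: eps0_def)
  moreover have "df_of (\<lambda>x. if x > 0 then 1 else 0) \<in> DeltaPlus"
    by (rule df_of_in_DeltaPlus) (auto split: if_splits dest: dense)
  ultimately show ?thesis by simp
qed

lemma epsInf_in_DeltaPlus [simp]: "epsInf \<in> DeltaPlus"
proof -
  have "epsInf = df_of (\<lambda>x. 0)"
    by (rule ext, rename_tac x, case_tac x) (auto simp: epsInf_def)
  moreover have "df_of (\<lambda>x. 0) \<in> DeltaPlus"
    by (rule df_of_in_DeltaPlus) auto
  ultimately show ?thesis by simp
qed

lemma eps_ereal [simp]:
  "eps0 (ereal x) = (if x > 0 then 1 else 0)" "epsInf (ereal x) = 0"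
  by (auto simp: eps0_def epsInf_def)

lemma df_le_eps0:
  assumes "F \<in> DeltaPlus" shows "df_le F eps0"
  by (rule df_le_DeltaPlusI[OF assms eps0_in_DeltaPlus])
     (auto simp: DeltaPlusD[OF assms] DeltaPlus_nonpos[OF assms])

lemma eps0_eqI:
  assumes "F \<in> DeltaPlus" "\<And>x. 0 < x \<Longrightarrow> 1 \<le> F (ereal x)"
  shows "F = eps0"
  by (rule DeltaPlus_eqI[OF assms(1) eps0_in_DeltaPlus])
     (auto simp: assms(2) DeltaPlusD[OF assms(1)] DeltaPlus_nonpos[OF assms(1)] intro: antisym)

lemma not_epsInfE:
  assumes "F \<in> DeltaPlus" "F \<noteq> epsInf"
  obtains x where "0 < F (ereal x)"
  using DeltaPlus_eqI[OF assms(1) epsInf_in_DeltaPlus] assms DeltaPlusD(1)[OF assms(1)]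
  by (metis eps_ereal(2) less_eq_real_def)

subsection \<open>Weak convergence\<close>

text \<open>A monotone function has only countably many discontinuities. Weak convergence speaks
  about continuity points only, so limit arguments first move to a point that is good for both
  functions.\<close>

lemma common_continuity_point:
  assumes "F \<in> DeltaPlus" "G \<in> DeltaPlus" "a < b"
  obtains x where "a < x" "x < b"
    "isCont (\<lambda>y. F (ereal y)) x" "isCont (\<lambda>y. G (ereal y)) x"
proof -
  let ?D = "\<lambda>F. {x. \<not> isCont (\<lambda>y. F (ereal y)) x}"
  have "countable (?D F)" if "F \<in> DeltaPlus" for F
    by (rule mono_ctble_discont) (auto simp: mono_def intro!: DeltaPlus_mono[OF that])
  then have "countable (?D F \<union> ?D G)" using assms by blast
  then have "\<not> {a<..<b} \<subseteq> ?D F \<union> ?D G"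
    using uncountable_open_interval[of a b] assms(3) countable_subset by blast
  then show ?thesis using that by auto
qed

text \<open>If \<open>F\<close> exceeded \<open>G\<close> at \<open>x\<close>, left-continuity would
  make \<open>F y > G x\<close> for some \<open>y < x\<close>. At a common continuity point between
  \<open>y\<close> and \<open>x\<close> the order passes to the limit, which contradicts
  this.\<close>

lemma weak_conv_le:
  assumes "F \<in> DeltaPlus" "G \<in> DeltaPlus" "weak_conv Fs F" "weak_conv Gs G"
    and "\<And>k x. Fs k (ereal x) \<le> Gs k (ereal x)"
  shows "df_le F G"
proof (rule df_le_DeltaPlusI[OF assms(1,2)], rule ccontr)
  fix x assume "\<not> F (ereal x) \<le> G (ereal x)"
  then obtain y where y: "y < x" "G (ereal x) < F (ereal y)"
    using DeltaPlus_left_approx[OF assms(1)] by (meson not_le)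
  obtain z where z: "y < z" "z < x" "isCont (\<lambda>y. F (ereal y)) z" "isCont (\<lambda>y. G (ereal y)) z"
    using common_continuity_point[OF assms(1,2) y(1)] by blast
  have "F (ereal z) \<le> G (ereal z)"
    by (rule LIMSEQ_le[of "\<lambda>k. Fs k (ereal z)" _ "\<lambda>k. Gs k (ereal z)"])
       (use assms z in \<open>auto simp: weak_conv_def\<close>)
  moreover have "F (ereal y) \<le> F (ereal z)" "G (ereal z) \<le> G (ereal x)"
    using DeltaPlus_mono assms(1,2) z by auto
  ultimately show False using y by linarith
qed

lemma weak_conv_unique:
  assumes "F \<in> DeltaPlus" "G \<in> DeltaPlus" "weak_conv Fs F" "weak_conv Fs G"
  shows "F = G"
  by (rule df_le_antisym; rule weak_conv_le[of _ _ Fs Fs]) (use assms in auto)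

lemma weak_conv_const: "weak_conv (\<lambda>_. F) F"
  by (auto simp: weak_conv_def)

lemma weak_conv_subseq: "weak_conv Fs F \<Longrightarrow> strict_mono r \<Longrightarrow> weak_conv (\<lambda>k. Fs (r k)) F"
  unfolding weak_conv_def using LIMSEQ_subseq_LIMSEQ[unfolded o_def] by blast

text \<open>All members of \<open>DeltaPlus\<close> vanish on nonpositive arguments and
  \<open>eps0\<close> is continuous on the positive ones, so only positive arguments carry
  information.\<close>

lemma weak_conv_eps0_iff:
  assumes "\<And>k. Fs k \<in> DeltaPlus"
  shows "weak_conv Fs eps0 \<longleftrightarrow> (\<forall>x>0. (\<lambda>k. Fs k (ereal x)) \<longlonglongrightarrow> 1)"
proof -
  have *: "isCont (\<lambda>y::real. if 0 < y then 1 else (0::real)) x" if "x > 0" for x :: real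
  proof -
    have "eventually (\<lambda>y::real. (if 0 < y then 1 else 0) = (1::real)) (nhds x)"
      using eventually_nhds_in_open[of "{0<..}" x] that by (auto elim: eventually_mono)
    then show ?thesis by (subst isCont_cong[of _ "\<lambda>_. 1"]) auto
  qed
  show ?thesis
    unfolding weak_conv_def by (auto simp: * DeltaPlus_nonpos[OF assms])
qed

text \<open>The pointwise limit \<open>f\<close> need not be left-continuous; \<open>L\<close> is its left-limit function.\<close>

lemma weak_conv_regularization:
  assumes Fs: "\<And>k. Fs k \<in> DeltaPlus" and lim: "\<And>x. (\<lambda>k. Fs k (ereal x)) \<longlonglongrightarrow> f x"
  obtains L where "L \<in> DeltaPlus" "\<And>x. L (ereal x) \<le> f x" "\<And>x y. x < y \<Longrightarrow> f x \<le> L (ereal y)"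
    "\<And>Gs. (\<And>x. (\<lambda>k. Gs k (ereal x)) \<longlonglongrightarrow> f x) \<Longrightarrow> weak_conv Gs L"
proof -
  define L where "L = df_of (\<lambda>x. Sup (f ` {..<x}))"
  have f: "0 \<le> f x" "f x \<le> 1" for x
    using LIMSEQ_le_const[OF lim, of 0] LIMSEQ_le_const2[OF lim, of x 1] DeltaPlusD[OF Fs] by auto
  have fm: "f x \<le> f y" if "x \<le> y" for x y
    by (rule LIMSEQ_le[OF lim lim]) (use DeltaPlus_mono[OF Fs that] in auto)
  have f0: "f x = 0" if "x \<le> 0" for x
    using lim[of x] DeltaPlus_nonpos[OF Fs, of "ereal x"] that by (simp add: LIMSEQ_const_iff)
  have bdd: "bdd_above (f ` A)" for A using f(2) by (auto simp: bdd_above_def)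
  have ne: "f ` {..<x} \<noteq> {}" for x by (auto simp: lessThan_def intro: lt_ex)
  have L1: "L (ereal x) \<le> f x" for x
    unfolding L_def by (simp, rule cSup_least[OF ne]) (auto intro: fm)
  have L2: "f x \<le> L (ereal y)" if "x < y" for x y
    unfolding L_def by (simp, rule cSup_upper[OF _ bdd]) (use that in auto)
  have L: "L \<in> DeltaPlus"
    unfolding L_def
  proof (rule df_of_in_DeltaPlus)
    fix x :: real
    show "0 \<le> Sup (f ` {..<x})"
      using L2[of "x - 1" x] f(1)[of "x - 1"] by (simp add: L_def)
    show "Sup (f ` {..<x}) \<le> 1" using L1[of x] f(2)[of x] by (simp add: L_def)
    fix y assume "x \<le> y"
    then show "Sup (f ` {..<x}) \<le> Sup (f ` {..<y})"
      by (intro cSup_subset_mono ne bdd) auto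
  next
    show "Sup (f ` {..<0}) = 0"
      using L1[of 0] L2[of "-1" 0] f0[of 0] f0[of "-1"] by (simp add: L_def)
  next
    fix x c assume "c < Sup (f ` {..<x})"
    then obtain y where "y < x" "c < f y" using less_cSup_iff[OF ne bdd] by auto
    moreover have "f y \<le> L (ereal ((x + y) / 2))" using \<open>y < x\<close> by (intro L2) auto
    ultimately show "\<exists>y<x. c < Sup (f ` {..<y})"
      by (intro exI[of _ "(x + y) / 2"]) (auto simp: L_def)
  qed
  \<comment> \<open>At a continuity point \<open>L\<close> equals its right limit, and
    \<open>L y\<close> is at least \<open>f x\<close> for every \<open>y > x\<close>.\<close>
  have L3: "L (ereal x) = f x" if "isCont (\<lambda>y. L (ereal y)) x" for x
  proof (rule antisym[OF L1])
    have "((\<lambda>y. L (ereal y)) \<longlongrightarrow> L (ereal x)) (at_right x)"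
      using that by (simp add: isCont_def filterlim_at_split)
    then show "f x \<le> L (ereal x)"
      by (rule tendsto_lowerbound)
         (use L2 in \<open>auto simp: eventually_at_filter trivial_limit_at_right_real\<close>)
  qed
  show ?thesis
    by (rule that[OF L L1 L2]) (auto simp: weak_conv_def L3)
qed

subsection \<open>Triangle functions\<close>

lemma triangle_functionD:
  assumes "triangle_function T" "F \<in> DeltaPlus" "G \<in> DeltaPlus"
  shows "T F G \<in> DeltaPlus" "H \<in> DeltaPlus \<Longrightarrow> T (T F G) H = T F (T G H)" "T F G = T G F"
    "H \<in> DeltaPlus \<Longrightarrow> df_le F G \<Longrightarrow> df_le (T F H) (T G H)" "T F eps0 = F"
  using assms unfolding triangle_function_def by blast+

text \<open>\<open>eps0\<close> is both the greatest element of \<open>DeltaPlus\<close> and the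
  unit, so replacing \<open>G\<close> by it can only increase the result.\<close>

lemma triangle_le_left:
  assumes "triangle_function T" "F \<in> DeltaPlus" "G \<in> DeltaPlus"
  shows "df_le (T F G) F"
proof -
  note T = triangle_functionD[OF assms(1)]
  have "df_le (T G F) (T eps0 F)"
    by (intro T df_le_eps0 assms) simp
  moreover have "T eps0 F = F" "T G F = T F G" using T(3,5) assms by (metis eps0_in_DeltaPlus)+
  ultimately show ?thesis by simp
qed

lemma continuous_tfD:
  assumes "continuous_tf T" "\<And>k. Fs k \<in> DeltaPlus" "F \<in> DeltaPlus" "\<And>k. Gs k \<in> DeltaPlus"
    "G \<in> DeltaPlus" "weak_conv Fs F" "weak_conv Gs G"
  shows "weak_conv (\<lambda>k. T (Fs k) (Gs k)) (T F G)"
  using assms(1)[unfolded continuous_tf_def, THEN spec, THEN spec, THEN spec, THEN spec, of Fs F Gs G]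
    assms(2-7) by simp

text \<open>Both sequences converge weakly to the regularization \<open>L\<close> of
  \<open>f\<close>. Continuity sends the second one to \<open>T L L\<close> as well, so uniqueness
  of weak limits makes \<open>L\<close> idempotent. Since \<open>f\<close> may fail to be
  left-continuous, it is only enclosed by values of \<open>L\<close>.\<close>

lemma archimedean_limit:
  assumes T: "triangle_function T" "continuous_tf T" "archimedean_tf T"
    and Fs: "\<And>k. Fs k \<in> DeltaPlus"
    and lim: "\<And>x. (\<lambda>k. Fs k (ereal x)) \<longlonglongrightarrow> f x"
      "\<And>x. (\<lambda>k. T (Fs k) (Fs k) (ereal x)) \<longlonglongrightarrow> f x"
  obtains L where "L = eps0 \<or> L = epsInf" "\<And>x. L (ereal x) \<le> f x" "\<And>x y. x < y \<Longrightarrow> f x \<le> L (ereal y)"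
proof -
  obtain L where L: "L \<in> DeltaPlus" "\<And>x. L (ereal x) \<le> f x" "\<And>x y. x < y \<Longrightarrow> f x \<le> L (ereal y)"
    "\<And>Gs. (\<And>x. (\<lambda>k. Gs k (ereal x)) \<longlonglongrightarrow> f x) \<Longrightarrow> weak_conv Gs L"
    using weak_conv_regularization[OF Fs lim(1)] by metis
  have "weak_conv Fs L" "weak_conv (\<lambda>k. T (Fs k) (Fs k)) L" using L(4) lim by auto
  moreover have "weak_conv (\<lambda>k. T (Fs k) (Fs k)) (T L L)"
    by (rule continuous_tfD) fact+
  ultimately have "T L L = L"
    using weak_conv_unique[of "T L L" L] triangle_functionD(1)[OF T(1)] L(1) by blast
  then have "L = eps0 \<or> L = epsInf" using T(3) L(1) by (simp add: archimedean_tf_def)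
  then show ?thesis using that L(2,3) by blast
qed

subsection \<open>The sup-convolution with respect to the product\<close>

text \<open>The triangle function induced by the product t-norm. The constraint
  \<open>u + v \<le> x\<close> gives the same supremum as equality, because the factors are
  nondecreasing, and it makes monotonicity in \<open>x\<close> immediate.\<close>

definition sup_conv :: "df \<Rightarrow> df \<Rightarrow> df" where
  "sup_conv F G = df_of (\<lambda>x. Sup {F (ereal u) * G (ereal v) | u v. u + v \<le> x})"

text \<open>In \<open>less_sup_conv_iff\<close> the constraint is strict: a witness with
  \<open>u + v = x\<close> can be moved slightly to the left by left-continuity of \<open>F\<close>.
  This slack gives left-continuity of the supremum and room for the limit arguments.\<close>

lemma
  assumes "F \<in> DeltaPlus" "G \<in> DeltaPlus"
  shows sup_conv_upper: "u + v \<le> x \<Longrightarrow> F (ereal u) * G (ereal v) \<le> sup_conv F G (ereal x)"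
    and sup_conv_least:
      "(\<And>u v. u + v \<le> x \<Longrightarrow> F (ereal u) * G (ereal v) \<le> c) \<Longrightarrow> sup_conv F G (ereal x) \<le> c"
    and less_sup_conv_iff:
      "0 \<le> c \<Longrightarrow> c < sup_conv F G (ereal x) \<longleftrightarrow> (\<exists>u v. u + v < x \<and> c < F (ereal u) * G (ereal v))"
proof -
  let ?S = "\<lambda>x. {F (ereal u) * G (ereal v) | u v. u + v \<le> x}"
  have bdd: "bdd_above (?S x)" for x
    by (rule bdd_aboveI[of _ 1]) (auto intro!: mult_le_one simp: DeltaPlusD assms)
  have ne: "?S x \<noteq> {}" for x
    using add_0_right[of x] by (metis (mono_tags, lifting) empty_iff mem_Collect_eq order_refl)
  show up: "u + v \<le> x \<Longrightarrow> F (ereal u) * G (ereal v) \<le> sup_conv F G (ereal x)" for u v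
    unfolding sup_conv_def by (simp, rule cSup_upper[OF _ bdd]) auto
  show "(\<And>u v. u + v \<le> x \<Longrightarrow> F (ereal u) * G (ereal v) \<le> c) \<Longrightarrow> sup_conv F G (ereal x) \<le> c"
    unfolding sup_conv_def by (simp, rule cSup_least[OF ne]) auto
  assume c: "0 \<le> c"
  show "c < sup_conv F G (ereal x) \<longleftrightarrow> (\<exists>u v. u + v < x \<and> c < F (ereal u) * G (ereal v))"
  proof
    assume "c < sup_conv F G (ereal x)"
    then obtain u v where uv: "u + v \<le> x" "c < F (ereal u) * G (ereal v)"
      unfolding sup_conv_def using less_cSup_iff[OF ne bdd, of c x] by auto
    have G: "0 < G (ereal v)"
      using uv(2) c DeltaPlusD(1)[OF assms(2), of "ereal v"]
      by (metis less_eq_real_def mult_zero_right not_le)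
    then have "c / G (ereal v) < F (ereal u)" using uv(2) by (simp add: field_simps)
    then obtain u' where "u' < u" "c / G (ereal v) < F (ereal u')"
      using DeltaPlus_left_approx[OF assms(1)] by blast
    then show "\<exists>u v. u + v < x \<and> c < F (ereal u) * G (ereal v)"
      using uv G by (intro exI[of _ u'] exI[of _ v]) (auto simp: field_simps)
  next
    assume "\<exists>u v. u + v < x \<and> c < F (ereal u) * G (ereal v)"
    then show "c < sup_conv F G (ereal x)" using up less_imp_le less_le_trans by blast
  qed
qed

lemma sup_conv_in_DeltaPlus [simp]:
  assumes "F \<in> DeltaPlus" "G \<in> DeltaPlus"
  shows "sup_conv F G \<in> DeltaPlus"
proof -
  let ?f = "\<lambda>x. sup_conv F G (ereal x)"
  have le: "?f x \<le> ?f y" if "x \<le> y" for x y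
    using that by (intro sup_conv_least[OF assms] sup_conv_upper[OF assms]) auto
  have 0: "0 \<le> ?f x" for x
    by (rule order_trans[OF _ sup_conv_upper[OF assms, of x 0]])
       (auto simp: DeltaPlusD assms)
  have "df_of ?f \<in> DeltaPlus"
  proof (rule df_of_in_DeltaPlus)
    fix x
    show "?f x \<le> 1"
      by (rule sup_conv_least[OF assms]) (auto intro!: mult_le_one simp: DeltaPlusD assms)
    fix c assume "c < ?f x" "0 \<le> c"
    then obtain u v where uv: "u + v < x" "c < F (ereal u) * G (ereal v)"
      using less_sup_conv_iff[OF assms] by blast
    then obtain y where "u + v < y" "y < x" using dense by blast
    then show "\<exists>y<x. c < ?f y" using uv less_sup_conv_iff[OF assms \<open>0 \<le> c\<close>] by blast
  next
    have "?f 0 \<le> 0"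
    proof (rule sup_conv_least[OF assms])
      fix u v :: real assume "u + v \<le> 0"
      then have "u \<le> 0 \<or> v \<le> 0" by linarith
      then show "F (ereal u) * G (ereal v) \<le> 0"
        using DeltaPlus_nonpos[OF assms(1), of u] DeltaPlus_nonpos[OF assms(2), of v] by auto
    qed
    then show "?f 0 = 0" using 0[of 0] by simp
  qed (use le 0 in auto)
  moreover have "df_of ?f = sup_conv F G" by (simp add: sup_conv_def)
  ultimately show ?thesis by simp
qed

lemma sup_conv_commute:
  assumes "F \<in> DeltaPlus" "G \<in> DeltaPlus"
  shows "sup_conv F G = sup_conv G F"
proof -
  have "df_le (sup_conv F G) (sup_conv G F)" if "F \<in> DeltaPlus" "G \<in> DeltaPlus" for F G
    by (rule df_le_DeltaPlusI; (rule sup_conv_least)?)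
       (auto simp: that mult.commute[of "F _"] intro!: sup_conv_upper)
  then show ?thesis using assms df_le_antisym by blast
qed

text \<open>Combined with \<open>less_sup_conv_iff\<close>, this reduces identities between
  convolutions to equivalences of existence statements, without handling suprema.\<close>

lemma DeltaPlus_eq_by_lessI:
  assumes "F \<in> DeltaPlus" "G \<in> DeltaPlus"
    and "\<And>x c. 0 \<le> c \<Longrightarrow> c < F (ereal x) \<longleftrightarrow> c < G (ereal x)"
  shows "F = G"
  by (rule DeltaPlus_eqI[OF assms(1,2)])
     (metis DeltaPlusD(1) assms linorder_neqE_linordered_idom less_irrefl)

text \<open>The right-hand side treats the three functions alike, and associativity is read off from
  this symmetry. Dividing by the positive outer factor reduces the nested supremum to the inner
  one.\<close>

lemma less_sup_conv3_iff:
  assumes "F \<in> DeltaPlus" "G \<in> DeltaPlus" "H \<in> DeltaPlus" "0 \<le> c"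
  shows "c < sup_conv (sup_conv F G) H (ereal x) \<longleftrightarrow>
    (\<exists>u v w. u + v + w < x \<and> c < F (ereal u) * G (ereal v) * H (ereal w))"
proof
  assume "c < sup_conv (sup_conv F G) H (ereal x)"
  then obtain s w where sw: "s + w < x" "c < sup_conv F G (ereal s) * H (ereal w)"
    using less_sup_conv_iff assms by (metis sup_conv_in_DeltaPlus)
  have H: "0 < H (ereal w)"
    using sw(2) assms(4) DeltaPlusD(1)[OF assms(3), of "ereal w"]
    by (metis less_eq_real_def mult_zero_right not_le)
  then have "c / H (ereal w) < sup_conv F G (ereal s)" using sw(2) by (simp add: field_simps)
  then obtain u v where "u + v < s" "c / H (ereal w) < F (ereal u) * G (ereal v)"
    using less_sup_conv_iff[OF assms(1,2), of "c / H (ereal w)"] H assms(4) by auto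
  then show "\<exists>u v w. u + v + w < x \<and> c < F (ereal u) * G (ereal v) * H (ereal w)"
    using sw(1) H by (intro exI[of _ u] exI[of _ v] exI[of _ w]) (auto simp: field_simps)
next
  assume "\<exists>u v w. u + v + w < x \<and> c < F (ereal u) * G (ereal v) * H (ereal w)"
  then obtain u v w where uvw: "u + v + w < x" "c < F (ereal u) * G (ereal v) * H (ereal w)"
    by blast
  have "F (ereal u) * G (ereal v) * H (ereal w) \<le> sup_conv F G (ereal (u + v)) * H (ereal w)"
    by (intro mult_right_mono sup_conv_upper) (auto simp: assms DeltaPlusD)
  also have "\<dots> \<le> sup_conv (sup_conv F G) H (ereal x)"
    by (rule sup_conv_upper) (use assms uvw in auto)
  finally show "c < sup_conv (sup_conv F G) H (ereal x)" using uvw by linarith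
qed

text \<open>The description by triples is invariant under cyclic permutation of the functions;
  commutativity turns the permuted product into the other bracketing.\<close>

lemma sup_conv_assoc:
  assumes "F \<in> DeltaPlus" "G \<in> DeltaPlus" "H \<in> DeltaPlus"
  shows "sup_conv (sup_conv F G) H = sup_conv F (sup_conv G H)"
proof -
  have "sup_conv (sup_conv F G) H = sup_conv (sup_conv G H) F"
  proof (rule DeltaPlus_eq_by_lessI)
    fix x c :: real assume c: "0 \<le> c"
    show "c < sup_conv (sup_conv F G) H (ereal x) \<longleftrightarrow> c < sup_conv (sup_conv G H) F (ereal x)"
    proof -
      have "u + v + w < x \<and> c < F (ereal u) * G (ereal v) * H (ereal w) \<longleftrightarrow>
          v + w + u < x \<and> c < G (ereal v) * H (ereal w) * F (ereal u)" for u v w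
        by (simp add: ac_simps)
      then show ?thesis
        unfolding less_sup_conv3_iff[OF assms c] less_sup_conv3_iff[OF assms(2,3,1) c]
        by blast
    qed
  qed (simp_all add: assms)
  then show ?thesis using sup_conv_commute assms by simp
qed

lemma sup_conv_mono:
  assumes "F \<in> DeltaPlus" "G \<in> DeltaPlus" "H \<in> DeltaPlus" "df_le F G"
  shows "df_le (sup_conv F H) (sup_conv G H)"
proof (rule df_le_DeltaPlusI)
  fix x show "sup_conv F H (ereal x) \<le> sup_conv G H (ereal x)"
  proof (rule sup_conv_least[OF assms(1,3)])
    fix u v assume "u + v \<le> x"
    have "F (ereal u) * H (ereal v) \<le> G (ereal u) * H (ereal v)"
      using assms by (auto simp: df_le_def DeltaPlusD intro: mult_right_mono)
    also have "\<dots> \<le> sup_conv G H (ereal x)"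
      by (rule sup_conv_upper) fact+
    finally show "F (ereal u) * H (ereal v) \<le> sup_conv G H (ereal x)" .
  qed
qed (simp_all add: assms)

lemma sup_conv_eps0:
  assumes "F \<in> DeltaPlus"
  shows "sup_conv F eps0 = F"
proof (rule DeltaPlus_eq_by_lessI)
  fix x c :: real assume c: "0 \<le> c"
  show "c < sup_conv F eps0 (ereal x) \<longleftrightarrow> c < F (ereal x)"
    unfolding less_sup_conv_iff[OF assms eps0_in_DeltaPlus c]
  proof
    assume "\<exists>u v. u + v < x \<and> c < F (ereal u) * eps0 (ereal v)"
    then obtain u v where "u + v < x" "c < F (ereal u) * eps0 (ereal v)" by blast
    with c have "u \<le> x" "c < F (ereal u)" by (auto split: if_splits)
    then show "c < F (ereal x)" using DeltaPlus_mono[OF assms, of u x] by linarith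
  next
    assume "c < F (ereal x)"
    then obtain u where "u < x" "c < F (ereal u)" using DeltaPlus_left_approx[OF assms] by blast
    then show "\<exists>u v. u + v < x \<and> c < F (ereal u) * eps0 (ereal v)"
      by (intro exI[of _ u] exI[of _ "(x - u) / 2"]) (auto simp: field_simps)
  qed
qed (simp_all add: assms)

lemma triangle_function_sup_conv: "triangle_function sup_conv"
  unfolding triangle_function_def
  using sup_conv_assoc sup_conv_commute sup_conv_mono sup_conv_eps0 by auto

lemma archimedean_sup_conv: "archimedean_tf sup_conv"
  unfolding archimedean_tf_def
proof (intro ballI impI)
  fix F assume F: "F \<in> DeltaPlus" and idem: "sup_conv F F = F"
  \<comment> \<open>If \<open>u + v \<le> x\<close>, one of \<open>u\<close>, \<open>v\<close> is at most \<open>x / 2\<close>, so \<open>F x = (F * F) x \<le> F (x / 2) F x\<close>.\<close>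
  have half: "F (ereal (x / 2)) = 1" if "0 < F (ereal x)" for x
  proof -
    have "sup_conv F F (ereal x) \<le> F (ereal (x / 2)) * F (ereal x)"
    proof (rule sup_conv_least[OF F F])
      fix u v :: real assume uv: "u + v \<le> x"
      have *: "F (ereal u) * F (ereal v) \<le> F (ereal (x / 2)) * F (ereal x)"
        if "u \<le> v" "u + v \<le> x" for u v
      proof (cases "0 \<le> u")
        case True
        then show ?thesis
          using that by (intro mult_mono DeltaPlus_mono[OF F]) (auto simp: DeltaPlusD[OF F])
      next
        case False
        then have "F (ereal u) = 0" using DeltaPlus_nonpos[OF F, of u] by auto
        then show ?thesis by (simp add: DeltaPlusD[OF F])
      qed
      show "F (ereal u) * F (ereal v) \<le> F (ereal (x / 2)) * F (ereal x)"
        using *[of u v] *[of v u] uv by (cases "u \<le> v") (auto simp: mult.commute add.commute)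
    qed
    then have "1 \<le> F (ereal (x / 2))" using that idem by simp
    then show ?thesis using DeltaPlusD(2)[OF F] antisym by blast
  qed
  show "F = eps0 \<or> F = epsInf"
  proof (cases "F = epsInf")
    case False
    then obtain x where x: "0 < F (ereal x)" using not_epsInfE[OF F] by blast
    \<comment> \<open>The value 1 obtained at \<open>x / 2\<close> is again positive, so halving can
      be repeated. As \<open>x / 2 ^ k\<close> tends to 0, monotonicity spreads the value 1 over all
      positive arguments.\<close>
    have pos: "0 < F (ereal (x / 2 ^ k))" for k
    proof (induction k)
      case (Suc k)
      then show ?case using half[OF Suc] by (simp add: field_simps)
    qed (use x in simp)
    have "F = eps0"
    proof (rule eps0_eqI[OF F])
      fix y :: real assume y: "0 < y"
      have half_le: "z / 2 \<le> y" if "z < y" for z using that y by simp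
      have "(\<lambda>k. x / 2 ^ k) \<longlonglongrightarrow> 0"
        by (rule LIMSEQ_divide_realpow_zero) simp
      then have "eventually (\<lambda>k. x / 2 ^ k < y) sequentially"
        using y by (rule order_tendstoD)
      then obtain k where "x / 2 ^ k < y" by (auto simp: eventually_sequentially)
      then have "x / 2 ^ k / 2 \<le> y" by (rule half_le)
      then show "1 \<le> F (ereal y)" using half[OF pos[of k]] DeltaPlus_mono[OF F] by fastforce
    qed
    then show ?thesis ..
  qed auto
qed

text \<open>Lower bounds pass to the limit by moving one good pair \<open>u\<close>,
  \<open>v\<close> to continuity points within the slack \<open>u + v < x\<close>. Upper bounds use
  compactness: near-optimal pairs for the approximants have a convergent subsequence, and continuity
  points just above its limit yield a pair that is too good for \<open>F\<close> and
  \<open>G\<close>.\<close>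

lemma continuous_sup_conv: "continuous_tf sup_conv"
  unfolding continuous_tf_def
proof (intro allI impI)
  fix Fs F Gs G
  assume Fs: "\<forall>n. Fs n \<in> DeltaPlus" and F: "F \<in> DeltaPlus"
    and Gs: "\<forall>n. Gs n \<in> DeltaPlus" and G: "G \<in> DeltaPlus"
    and wF: "weak_conv Fs F" and wG: "weak_conv Gs G"
  let ?K = "\<lambda>n. sup_conv (Fs n) (Gs n)"
  have lim: "(\<lambda>n. Fs n (ereal u) * Gs n (ereal v)) \<longlonglongrightarrow> F (ereal u) * G (ereal v)"
    if "isCont (\<lambda>y. F (ereal y)) u" "isCont (\<lambda>y. G (ereal y)) v" for u v
    using wF wG that by (intro tendsto_mult) (auto simp: weak_conv_def)
  show "weak_conv ?K (sup_conv F G)"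
    unfolding weak_conv_def
  proof (intro allI impI)
    fix x assume cont: "isCont (\<lambda>y. sup_conv F G (ereal y)) x"
    show "(\<lambda>n. ?K n (ereal x)) \<longlonglongrightarrow> sup_conv F G (ereal x)"
    proof (rule order_tendstoI)
      fix c assume c: "c < sup_conv F G (ereal x)"
      show "eventually (\<lambda>n. c < ?K n (ereal x)) sequentially"
      proof (cases "0 \<le> c")
        case False
        then show ?thesis
          using DeltaPlusD(1)[OF sup_conv_in_DeltaPlus] Fs Gs
          by (intro always_eventually) (meson less_le_trans not_le)
      next
        case True
        then obtain u v where uv: "u + v < x" "c < F (ereal u) * G (ereal v)"
          using c less_sup_conv_iff[OF F G] by blast
        define d where "d = (x - u - v) / 2"
        have d: "0 < d" using uv by (simp add: d_def)
        obtain u' where u': "u < u'" "u' < u + d" "isCont (\<lambda>y. F (ereal y)) u'"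
          using common_continuity_point[OF F F, of u "u + d"] d by auto
        obtain v' where v': "v < v'" "v' < v + d" "isCont (\<lambda>y. G (ereal y)) v'"
          using common_continuity_point[OF G G, of v "v + d"] d by auto
        have "F (ereal u) * G (ereal v) \<le> F (ereal u') * G (ereal v')"
          using u' v' by (intro mult_mono DeltaPlus_mono[OF F] DeltaPlus_mono[OF G])
            (auto simp: DeltaPlusD F G)
        then have "c < F (ereal u') * G (ereal v')" using uv by simp
        with lim[OF u'(3) v'(3)]
        have "eventually (\<lambda>n. c < Fs n (ereal u') * Gs n (ereal v')) sequentially"
          by (rule order_tendstoD)
        moreover have "Fs n (ereal u') * Gs n (ereal v') \<le> ?K n (ereal x)" for n
          using Fs Gs u' v' by (intro sup_conv_upper) (auto simp: d_def field_simps)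
        ultimately show ?thesis by (auto elim!: eventually_mono intro: less_le_trans)
      qed
    next
      fix d assume d: "sup_conv F G (ereal x) < d"
      show "eventually (\<lambda>n. ?K n (ereal x) < d) sequentially"
      proof (rule ccontr)
        assume "\<not> ?thesis"
        then have freq: "frequently (\<lambda>n. d \<le> ?K n (ereal x)) sequentially"
          by (simp add: frequently_def not_le)
        have "0 \<le> sup_conv F G (ereal x)" by (simp add: DeltaPlusD F G)
        obtain d' where d': "sup_conv F G (ereal x) < d'" "d' < d" using d dense by blast
        have d'0: "0 \<le> d'" using d'(1) \<open>0 \<le> sup_conv F G (ereal x)\<close> by simp
        \<comment> \<open>Continuity at \<open>x\<close> provides \<open>x' > x\<close> at which the
          bound still holds; the gap pays for rounding \<open>u\<close> and \<open>v\<close> up to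
          continuity points.\<close>
        have "eventually (\<lambda>y. sup_conv F G (ereal y) < d') (at_right x)"
          using cont d'(1) unfolding isCont_def filterlim_at_split
          by (auto intro: order_tendstoD(2))
        then obtain b where b: "b > x" "\<And>y. x < y \<Longrightarrow> y < b \<Longrightarrow> sup_conv F G (ereal y) < d'"
          unfolding eventually_at_right_field by blast
        define x' where "x' = (x + b) / 2"
        have x': "x < x'" "sup_conv F G (ereal x') < d'"
          using b by (auto simp: x'_def)
        obtain r :: "nat \<Rightarrow> nat" where r: "strict_mono r" "\<And>k. d \<le> ?K (r k) (ereal x)"
        proof -
          have "infinite {n. d \<le> ?K n (ereal x)}"
            using freq by (simp add: INFM_iff_infinite flip: cofinite_eq_sequentially)
          then show ?thesis using that infinite_enumerate by blast
        qed
        have "\<exists>u v. u + v < x \<and> d' < Fs (r k) (ereal u) * Gs (r k) (ereal v)" for k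
          using less_sup_conv_iff[of "Fs (r k)" "Gs (r k)" d' x] Fs Gs d'0 r(2)[of k] d' by auto
        then obtain u v where uv: "\<And>k. u k + v k < x"
          "\<And>k. d' < Fs (r k) (ereal (u k)) * Gs (r k) (ereal (v k))"
          by metis
        \<comment> \<open>A product above \<open>d' \<ge> 0\<close> has no vanishing factor, so both
          arguments are positive and \<open>u k\<close> stays in the compact interval from 0 to
          \<open>x\<close>.\<close>
        have upos: "0 < u k" "0 < v k" for k
          using uv(2)[of k] d'0 Fs Gs DeltaPlus_nonpos[of "Fs (r k)" "ereal (u k)"]
            DeltaPlus_nonpos[of "Gs (r k)" "ereal (v k)"] by fastforce+
        have "u k \<in> {0..x}" for k using upos[of k] uv(1)[of k] by auto
        moreover have "seq_compact {0..x}" by (simp add: compact_imp_seq_compact)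
        ultimately obtain l s where s: "strict_mono s" "(u \<circ> s) \<longlonglongrightarrow> l"
          by (metis seq_compactE)
        define e where "e = (x' - x) / 2"
        have e: "0 < e" using x' by (simp add: e_def)
        obtain u' where u': "l < u'" "u' < l + e" "isCont (\<lambda>y. F (ereal y)) u'"
          using common_continuity_point[OF F F, of l "l + e"] e by auto
        obtain v' where v': "x - l < v'" "v' < x - l + e" "isCont (\<lambda>y. G (ereal y)) v'"
          using common_continuity_point[OF G G, of "x - l" "x - l + e"] e by auto
        have "eventually (\<lambda>k. u (s k) < u') sequentially"
          using order_tendstoD(2)[OF s(2) u'(1)] by simp
        moreover have "eventually (\<lambda>k. x - v' < u (s k)) sequentially"
          using order_tendstoD(1)[OF s(2), of "x - v'"] v'(1) by simp
        ultimately have "eventually (\<lambda>k. d' \<le> Fs (r (s k)) (ereal u') * Gs (r (s k)) (ereal v')) sequentially"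
        proof eventually_elim
          case (elim k)
          have "v (s k) < v'" using uv(1)[of "s k"] elim by linarith
          then have "Fs (r (s k)) (ereal (u (s k))) * Gs (r (s k)) (ereal (v (s k)))
              \<le> Fs (r (s k)) (ereal u') * Gs (r (s k)) (ereal v')"
            using elim Fs Gs by (intro mult_mono DeltaPlus_mono) (auto simp: DeltaPlusD)
          then show ?case using uv(2)[of "s k"] by linarith
        qed
        moreover have "(\<lambda>k. Fs (r (s k)) (ereal u') * Gs (r (s k)) (ereal v'))
            \<longlonglongrightarrow> F (ereal u') * G (ereal v')"
          using LIMSEQ_subseq_LIMSEQ[OF lim[OF u'(3) v'(3)] strict_mono_o[OF r(1) s(1)]]
          by (simp add: o_def)
        ultimately have "d' \<le> F (ereal u') * G (ereal v')"
          by (intro tendsto_lowerbound) auto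
        also have "\<dots> \<le> sup_conv F G (ereal x')"
          using u' v' by (intro sup_conv_upper F G) (auto simp: e_def field_simps)
        finally show False using x' by simp
      qed
    qed
  qed
qed

subsection \<open>A real PN space under the sup-convolution\<close>

text \<open>The product adds exponents, so the triangle inequality (N3) becomes subadditivity of
  \<open>max 0 (\<bar>t\<bar> - x)\<close> in the pair of \<open>t\<close> and \<open>x\<close>, and
  (N4) becomes its positive homogeneity.\<close>

definition exp_norm :: "real \<Rightarrow> df" where
  "exp_norm t = df_of (\<lambda>x. if x \<le> 0 then 0 else exp (- max 0 (\<bar>t\<bar> - x)))"

lemma exp_norm_in_DeltaPlus [simp]: "exp_norm t \<in> DeltaPlus"
  unfolding exp_norm_def
proof (rule df_of_in_DeltaPlus)
  let ?g = "\<lambda>x. exp (- max 0 (\<bar>t\<bar> - x))"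
  fix x c :: real assume c: "c < (if x \<le> 0 then 0 else ?g x)" "0 \<le> c"
  then have x: "0 < x" "c < ?g x" by (auto split: if_splits)
  have "(?g \<longlongrightarrow> ?g x) (at_left x)" by (intro tendsto_intros)
  then have "eventually (\<lambda>y. c < ?g y) (at_left x)"
    using x(2) by (rule order_tendstoD)
  then obtain b where b: "b < x" "\<And>y. b < y \<Longrightarrow> y < x \<Longrightarrow> c < ?g y"
    unfolding eventually_at_left_field by blast
  obtain y where "max 0 b < y" "y < x" using dense[of "max 0 b" x] x b by auto
  then show "\<exists>y<x. c < (if y \<le> 0 then 0 else ?g y)" using b by (intro exI[of _ y]) auto
qed auto

lemma exp_norm_ereal:
  "exp_norm t (ereal x) = (if x \<le> 0 then 0 else exp (- max 0 (\<bar>t\<bar> - x)))"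
  by (simp add: exp_norm_def)

lemma exp_norm_eq_eps0_iff: "exp_norm t = eps0 \<longleftrightarrow> t = 0"
proof
  assume "exp_norm t = eps0"
  then have "exp_norm t (ereal (\<bar>t\<bar> / 2)) = eps0 (ereal (\<bar>t\<bar> / 2))" by simp
  then show "t = 0" by (auto simp: exp_norm_ereal max_def split: if_splits)
next
  assume "t = 0"
  then show "exp_norm t = eps0" by (intro eps0_eqI) (auto simp: exp_norm_ereal)
qed

lemma PN_space_exp_norm: "PN_space exp_norm sup_conv sup_conv"
  unfolding PN_space_def
proof (intro conjI allI ballI triangle_function_sup_conv continuous_sup_conv)
  fix s t :: real
  show "df_le (sup_conv (exp_norm s) (exp_norm t)) (exp_norm (s + t))"
  proof (rule df_le_DeltaPlusI)
    fix x show "sup_conv (exp_norm s) (exp_norm t) (ereal x) \<le> exp_norm (s + t) (ereal x)"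
      by (rule sup_conv_least)
         (auto simp: exp_norm_ereal simp flip: exp_add)
  qed simp_all
next
  fix t l :: real assume l: "l \<in> {0..1}"
  show "df_le (exp_norm t) (sup_conv (exp_norm (l *\<^sub>R t)) (exp_norm ((1 - l) *\<^sub>R t)))"
  proof (cases "l = 0 \<or> l = 1")
    \<comment> \<open>The endpoints are treated apart: splitting \<open>x\<close> in the ratio
      \<open>l\<close> to \<open>1 - l\<close> would evaluate one factor at 0, where every
      distribution function vanishes. Here that factor is the unit \<open>eps0\<close>.\<close>
    case True
    have [simp]: "exp_norm 0 = eps0" by (simp add: exp_norm_eq_eps0_iff)
    show ?thesis using True sup_conv_commute[of eps0 "exp_norm t"] sup_conv_eps0[of "exp_norm t"]
      by (auto simp: df_le_def)
  next
    case False
    then have l: "0 < l" "l < 1" using l by auto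
    show ?thesis
    proof (rule df_le_DeltaPlusI)
      fix x
      show "exp_norm t (ereal x) \<le> sup_conv (exp_norm (l *\<^sub>R t)) (exp_norm ((1 - l) *\<^sub>R t)) (ereal x)"
      proof (cases "x \<le> 0")
        case True
        then show ?thesis by (simp add: exp_norm_ereal[of t] DeltaPlusD)
      next
        case False
        have m: "max 0 (\<bar>a * t\<bar> - a * x) = a * max 0 (\<bar>t\<bar> - x)" if "0 < a" for a
          using that by (auto simp: max_def abs_mult algebra_simps mult_le_cancel_left)
        have "exp_norm t (ereal x) = exp_norm (l * t) (ereal (l * x)) * exp_norm ((1 - l) * t) (ereal ((1 - l) * x))"
          using False l m[of l] m[of "1 - l"]
          by (simp add: exp_norm_ereal mult_le_0_iff flip: exp_add) (simp add: algebra_simps)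
        also have "\<dots> \<le> sup_conv (exp_norm (l * t)) (exp_norm ((1 - l) * t)) (ereal x)"
          by (rule sup_conv_upper) (auto simp: algebra_simps)
        finally show ?thesis by simp
      qed
    qed simp_all
  qed
qed (auto simp: exp_norm_eq_eps0_iff df_le_def, simp_all only: exp_norm_def abs_minus_cancel)

lemma exp_norm_neq_epsInf: "exp_norm t \<noteq> epsInf"
proof
  assume "exp_norm t = epsInf"
  then have "exp_norm t (ereal 1) = epsInf (ereal 1)" by simp
  then show False by (simp add: exp_norm_ereal)
qed

subsection \<open>Changes of scale\<close>

text \<open>Bijections of the whole line make \<open>inv\<close> a two-sided inverse without side
  conditions. The half-line and the unit interval are singled out later by fixed points.\<close>

definition order_bij :: "(real \<Rightarrow> real) \<Rightarrow> bool" where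
  "order_bij h \<longleftrightarrow> strict_mono h \<and> surj h"

lemma order_bij_inv:
  assumes "order_bij h"
  shows "order_bij (inv h)" "\<And>x. inv h (h x) = x" "\<And>x. h (inv h x) = x"
proof -
  have h: "strict_mono h" "inj h" "surj h"
    using assms strict_mono_imp_inj_on by (auto simp: order_bij_def)
  show 1: "\<And>x. inv h (h x) = x" "\<And>x. h (inv h x) = x"
    using h by (simp_all add: surj_f_inv_f)
  have "strict_mono (inv h)"
    by (rule strict_monoI) (metis 1(2) h(1) strict_mono_less)
  then show "order_bij (inv h)"
    unfolding order_bij_def using h(2) by (simp add: inj_imp_surj_inv)
qed

text \<open>Through the inverse, \<open>c < h y\<close> becomes \<open>inv h c < y\<close>, so order
  neighbourhoods of \<open>h x\<close> pull back to order neighbourhoods of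
  \<open>x\<close>.\<close>

lemma order_bij_isCont:
  assumes "order_bij h"
  shows "isCont h x"
proof -
  note h = order_bij_inv[OF assms]
  have less: "h a < h b \<longleftrightarrow> a < b" for a b
    using assms by (simp add: order_bij_def strict_mono_less)
  show ?thesis
    unfolding isCont_def
  proof (rule order_tendstoI)
    fix c assume "c < h x"
    then have "inv h c < x" by (metis h(3) less)
    then have "eventually (\<lambda>y. inv h c < y) (at x)"
      by (rule order_tendstoD(1)[OF tendsto_ident_at])
    then show "eventually (\<lambda>y. c < h y) (at x)"
      by eventually_elim (metis h(3) less)
  next
    fix c assume "h x < c"
    then have "x < inv h c" by (metis h(3) less)
    then have "eventually (\<lambda>y. y < inv h c) (at x)"
      by (rule order_tendstoD(2)[OF tendsto_ident_at])
    then show "eventually (\<lambda>y. h y < c) (at x)"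
      by eventually_elim (metis h(3) less)
  qed
qed

definition rescale :: "(real \<Rightarrow> real) \<Rightarrow> (real \<Rightarrow> real) \<Rightarrow> df \<Rightarrow> df" where
  "rescale \<theta> \<eta> F = df_of (\<lambda>x. \<theta> (F (ereal (\<eta> x))))"

lemma rescale_ereal [simp]: "rescale \<theta> \<eta> F (ereal x) = \<theta> (F (ereal (\<eta> x)))"
  by (simp add: rescale_def)

text \<open>With these fixed points, acting by \<open>\<theta>\<close> on values and by
  \<open>\<eta>\<close> on arguments is an order automorphism of \<open>DeltaPlus\<close> that fixes
  \<open>eps0\<close> and \<open>epsInf\<close> and respects weak convergence. Hence conjugation
  transports the whole PN structure.\<close>

locale scale_change =
  fixes \<theta> \<eta> :: "real \<Rightarrow> real"
  assumes \<theta>: "order_bij \<theta>" "\<theta> 0 = 0" "\<theta> 1 = 1"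
    and \<eta>: "order_bij \<eta>" "\<eta> 0 = 0"
begin

lemma \<theta>_le: "\<theta> a \<le> \<theta> b \<longleftrightarrow> a \<le> b" and \<eta>_le: "\<eta> a \<le> \<eta> b \<longleftrightarrow> a \<le> b"
  and \<theta>_less: "\<theta> a < \<theta> b \<longleftrightarrow> a < b" and \<eta>_less: "\<eta> a < \<eta> b \<longleftrightarrow> a < b"
  using \<theta>(1) \<eta>(1) by (auto simp: order_bij_def strict_mono_less_eq strict_mono_less)

lemma rescale_in_DeltaPlus [simp]:
  assumes F: "F \<in> DeltaPlus"
  shows "rescale \<theta> \<eta> F \<in> DeltaPlus"
  unfolding rescale_def
proof (rule df_of_in_DeltaPlus)
  fix x c assume "c < \<theta> (F (ereal (\<eta> x)))"
  then have "inv \<theta> c < F (ereal (\<eta> x))" by (metis \<theta>_less order_bij_inv(3)[OF \<theta>(1)])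
  then obtain y where "y < \<eta> x" "inv \<theta> c < F (ereal y)"
    using DeltaPlus_left_approx[OF F] by blast
  then have "inv \<eta> y < x \<and> c < \<theta> (F (ereal (\<eta> (inv \<eta> y))))"
    by (metis \<theta>_less \<eta>_less order_bij_inv(3)[OF \<theta>(1)] order_bij_inv(3)[OF \<eta>(1)])
  then show "\<exists>y<x. c < \<theta> (F (ereal (\<eta> y)))" by blast
next
  fix x
  show "0 \<le> \<theta> (F (ereal (\<eta> x)))" using \<theta>_le[of 0] \<theta>(2) DeltaPlusD(1)[OF F] by simp
  show "\<theta> (F (ereal (\<eta> x))) \<le> 1" using \<theta>_le[of _ 1] \<theta>(3) DeltaPlusD(2)[OF F] by simp
qed (auto simp: \<theta>_le \<eta>_le \<eta>(2) \<theta>(2) DeltaPlus_nonpos[OF F] intro!: DeltaPlus_mono[OF F])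

lemma rescale_mono:
  assumes "F \<in> DeltaPlus" "G \<in> DeltaPlus" "df_le F G"
  shows "df_le (rescale \<theta> \<eta> F) (rescale \<theta> \<eta> G)"
  by (rule df_le_DeltaPlusI) (use assms in \<open>auto simp: \<theta>_le df_le_def\<close>)

lemma rescale_eps0 [simp]: "rescale \<theta> \<eta> eps0 = eps0"
  by (rule DeltaPlus_eqI) (use \<eta>_less[of 0] in \<open>auto simp: \<theta> \<eta>\<close>)

lemma rescale_epsInf [simp]: "rescale \<theta> \<eta> epsInf = epsInf"
  by (rule DeltaPlus_eqI) (auto simp: \<theta> \<eta>)

lemma scale_change_inv: "scale_change (inv \<theta>) (inv \<eta>)"
  by unfold_locales (metis order_bij_inv \<theta> \<eta>)+

lemma rescale_inv:
  assumes "F \<in> DeltaPlus"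
  shows "rescale (inv \<theta>) (inv \<eta>) (rescale \<theta> \<eta> F) = F"
    "rescale \<theta> \<eta> (rescale (inv \<theta>) (inv \<eta>) F) = F"
proof -
  interpret i: scale_change "inv \<theta>" "inv \<eta>" by (rule scale_change_inv)
  note inv = order_bij_inv[OF \<theta>(1)] order_bij_inv[OF \<eta>(1)]
  show "rescale (inv \<theta>) (inv \<eta>) (rescale \<theta> \<eta> F) = F"
    "rescale \<theta> \<eta> (rescale (inv \<theta>) (inv \<eta>) F) = F"
    by (rule DeltaPlus_eqI; simp add: assms inv)+
qed

text \<open>Undoing the continuous maps \<open>\<theta>\<close> and \<open>\<eta>\<close> shows that
  a continuity point \<open>x\<close> of the rescaled limit gives a continuity point
  \<open>\<eta> x\<close> of \<open>F\<close>, where the convergence can be used.\<close>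

lemma weak_conv_rescale:
  assumes "weak_conv Fs F"
  shows "weak_conv (\<lambda>k. rescale \<theta> \<eta> (Fs k)) (rescale \<theta> \<eta> F)"
  unfolding weak_conv_def
proof (intro allI impI)
  note inv = order_bij_inv[OF \<theta>(1)] order_bij_inv[OF \<eta>(1)]
  fix x assume "isCont (\<lambda>y. rescale \<theta> \<eta> F (ereal y)) x"
  then have "isCont (\<lambda>y. \<theta> (F (ereal (\<eta> y)))) (inv \<eta> (\<eta> x))"
    by (simp add: inv)
  from isCont_o2[OF isCont_o2[OF order_bij_isCont[OF inv(4)] this] order_bij_isCont[OF inv(1)]]
  have "isCont (\<lambda>y. F (ereal y)) (\<eta> x)"
    by (simp add: inv)
  then have "(\<lambda>k. Fs k (ereal (\<eta> x))) \<longlonglongrightarrow> F (ereal (\<eta> x))"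
    using assms by (auto simp: weak_conv_def)
  then show "(\<lambda>k. rescale \<theta> \<eta> (Fs k) (ereal x)) \<longlonglongrightarrow> rescale \<theta> \<eta> F (ereal x)"
    unfolding rescale_ereal by (rule isCont_tendsto_compose[OF order_bij_isCont[OF \<theta>(1)]])
qed

definition conj_tf :: "(df \<Rightarrow> df \<Rightarrow> df) \<Rightarrow> df \<Rightarrow> df \<Rightarrow> df" where
  "conj_tf T F G = rescale \<theta> \<eta> (T (rescale (inv \<theta>) (inv \<eta>) F) (rescale (inv \<theta>) (inv \<eta>) G))"

lemma triangle_function_conj_tf:
  assumes "triangle_function T"
  shows "triangle_function (conj_tf T)"
proof -
  interpret i: scale_change "inv \<theta>" "inv \<eta>" by (rule scale_change_inv)
  note T = triangle_functionD[OF assms]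
  show ?thesis
    unfolding triangle_function_def conj_tf_def
  proof (intro conjI ballI impI)
    fix F G assume FG: "F \<in> DeltaPlus" "G \<in> DeltaPlus"
    show "rescale \<theta> \<eta> (T (rescale (inv \<theta>) (inv \<eta>) F) (rescale (inv \<theta>) (inv \<eta>) G))
      = rescale \<theta> \<eta> (T (rescale (inv \<theta>) (inv \<eta>) G) (rescale (inv \<theta>) (inv \<eta>) F))"
      using T(3) FG by (metis i.rescale_in_DeltaPlus)
  qed (simp_all add: rescale_inv rescale_mono i.rescale_mono T(1,2,4,5))
qed

lemma continuous_conj_tf:
  assumes "continuous_tf T"
  shows "continuous_tf (conj_tf T)"
proof -
  interpret i: scale_change "inv \<theta>" "inv \<eta>" by (rule scale_change_inv)
  show ?thesis
    unfolding continuous_tf_def conj_tf_def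
    by (intro allI impI weak_conv_rescale assms[unfolded continuous_tf_def, rule_format])
       (auto intro: i.weak_conv_rescale)
qed

lemma archimedean_conj_tf:
  assumes "triangle_function T" "archimedean_tf T"
  shows "archimedean_tf (conj_tf T)"
  unfolding archimedean_tf_def conj_tf_def
proof (intro ballI impI)
  interpret i: scale_change "inv \<theta>" "inv \<eta>" by (rule scale_change_inv)
  fix F assume F: "F \<in> DeltaPlus"
  let ?G = "rescale (inv \<theta>) (inv \<eta>) F"
  assume idem: "rescale \<theta> \<eta> (T ?G ?G) = F"
  have "T ?G ?G \<in> DeltaPlus" using assms(1) F by (auto simp: triangle_function_def)
  then have "T ?G ?G = ?G" using idem rescale_inv(1) by metis
  then have "?G = eps0 \<or> ?G = epsInf" using assms(2) F by (auto simp: archimedean_tf_def)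
  then show "F = eps0 \<or> F = epsInf" using rescale_inv(2)[OF F] by auto
qed

lemma PN_space_conj:
  assumes "PN_space \<nu> T Ts"
  shows "PN_space (\<lambda>p. rescale \<theta> \<eta> (\<nu> p)) (conj_tf T) (conj_tf Ts)"
proof -
  interpret i: scale_change "inv \<theta>" "inv \<eta>" by (rule scale_change_inv)
  note PN = assms[unfolded PN_space_def]
  have tf: "triangle_function T" "triangle_function Ts" and ct: "continuous_tf T" "continuous_tf Ts"
    and \<nu>: "\<And>p. \<nu> p \<in> DeltaPlus" using PN by auto
  have [simp]: "T F G \<in> DeltaPlus" "Ts F G \<in> DeltaPlus" if "F \<in> DeltaPlus" "G \<in> DeltaPlus" for F G
    using tf that by (auto simp: triangle_function_def)
  have eq: "rescale \<theta> \<eta> F = eps0 \<longleftrightarrow> F = eps0" if "F \<in> DeltaPlus" for F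
    using rescale_inv(1)[OF that] by (metis i.rescale_eps0 rescale_eps0)
  show ?thesis
    unfolding PN_space_def
    using PN by (intro conjI triangle_function_conj_tf continuous_conj_tf tf ct)
      (auto simp: conj_tf_def rescale_inv \<nu> eq intro!: rescale_mono)
qed

end

subsection \<open>Domination by a change of scale\<close>

text \<open>\<open>\<beta>\<close> interpolates linearly between the values \<open>c k\<close> at
  the integers. Strict increase of \<open>c\<close> makes it strictly monotone; unboundedness on
  both sides makes it onto.\<close>

lemma interpolation_order_bij:
  fixes c :: "int \<Rightarrow> real"
  assumes inc: "\<And>k. c k < c (k + 1)"
    and lower: "\<And>K. \<exists>k. c k < K" and upper: "\<And>K. \<exists>k. K < c k"
  obtains \<beta> where "order_bij \<beta>" "\<And>z. c \<lfloor>z\<rfloor> \<le> \<beta> z"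
proof -
  define \<beta> where "\<beta> z = c \<lfloor>z\<rfloor> + frac z * (c (\<lfloor>z\<rfloor> + 1) - c \<lfloor>z\<rfloor>)" for z :: real
  have cm: "c i \<le> c j" if "i \<le> j" for i j
    using that by (induction j rule: int_ge_induct) (auto intro: order_trans less_imp_le[OF inc])
  have lo: "c \<lfloor>z\<rfloor> \<le> \<beta> z" for z
    using inc[of "\<lfloor>z\<rfloor>"] by (auto simp: \<beta>_def frac_ge_0)
  have hi: "\<beta> z < c (\<lfloor>z\<rfloor> + 1)" for z
  proof -
    have "frac z * (c (\<lfloor>z\<rfloor> + 1) - c \<lfloor>z\<rfloor>) < 1 * (c (\<lfloor>z\<rfloor> + 1) - c \<lfloor>z\<rfloor>)"
      using inc[of "\<lfloor>z\<rfloor>"] by (intro mult_strict_right_mono frac_lt_1) auto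
    then show ?thesis by (simp add: \<beta>_def)
  qed
  have "strict_mono \<beta>"
  proof (rule strict_monoI)
    fix x y :: real assume xy: "x < y"
    show "\<beta> x < \<beta> y"
    proof (cases "\<lfloor>x\<rfloor> = \<lfloor>y\<rfloor>")
      case True
      then have "frac x < frac y" using xy by (simp add: frac_def)
      then show ?thesis using True inc[of "\<lfloor>y\<rfloor>"] by (simp add: \<beta>_def)
    next
      case False
      then have "\<lfloor>x\<rfloor> + 1 \<le> \<lfloor>y\<rfloor>" using floor_mono[of x y] xy by linarith
      then show ?thesis using cm[of "\<lfloor>x\<rfloor> + 1" "\<lfloor>y\<rfloor>"] hi[of x] lo[of y] by linarith
    qed
  qed
  moreover have "surj \<beta>"
  proof (unfold surj_def, rule allI)
    fix y
    obtain i j where ij: "c i < y" "y < c j" using lower upper by blast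
    have "i < j" using ij cm[of j i] by (cases "i < j") auto
    have "\<exists>k. c k \<le> y \<and> y < c (k + 1)"
    proof (rule ccontr)
      assume no: "\<nexists>k. c k \<le> y \<and> y < c (k + 1)"
      have "c k \<le> y" if "i \<le> k" for k
        using that by (induction k rule: int_ge_induct) (use ij no in \<open>auto simp: not_less\<close>)
      then show False using ij \<open>i < j\<close> by (meson less_imp_le not_le)
    qed
    then obtain k where k: "c k \<le> y" "y < c (k + 1)" by blast
    define f where "f = (y - c k) / (c (k + 1) - c k)"
    have f: "0 \<le> f" "f < 1" "f * (c (k + 1) - c k) = y - c k"
      using k inc[of k] by (auto simp: f_def field_simps)
    have fl: "\<lfloor>of_int k + f\<rfloor> = k" using f by (simp add: floor_eq_iff)
    have "\<beta> (of_int k + f) = y" using f(3) by (simp add: \<beta>_def frac_def fl)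
    then show "\<exists>x. y = \<beta> x" by metis
  qed
  ultimately show ?thesis using that lo by (simp add: order_bij_def)
qed

text \<open>On logarithmic scales the positive half-line becomes the whole line, where samples of
  \<open>a\<close> can be interpolated. The assumption \<open>small\<close> lets the samples tend to
  minus infinity on the left, so the majorant still tends to 0 at 0.\<close>

lemma order_bij_dominating:
  fixes a :: "real \<Rightarrow> real"
  assumes nonneg: "\<And>x. 0 < x \<Longrightarrow> 0 \<le> a x"
    and mono: "\<And>x y. 0 < x \<Longrightarrow> x \<le> y \<Longrightarrow> a x \<le> a y"
    and small: "\<And>e. 0 < e \<Longrightarrow> \<exists>x>0. a x < e"
  obtains \<eta> where "order_bij \<eta>" "\<eta> 0 = 0" "\<And>x. 0 < x \<Longrightarrow> a x < \<eta> x"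
proof -
  \<comment> \<open>The index \<open>k + 1\<close> lets the node at the floor of \<open>ln x\<close>
    control \<open>a\<close> up to the right end of the cell containing \<open>x\<close>. The added
    exponential makes the argument of \<open>ln\<close> positive, strictly increasing and
    unbounded.\<close>
  define c where "c k = ln (a (exp (of_int (k + 1))) + exp (of_int (k + 1)))" for k :: int
  have pos: "0 < a (exp z) + exp z" for z by (simp add: add_nonneg_pos nonneg)
  have upper: "\<exists>k. K < c k" for K
  proof -
    have "of_int (k + 1) \<le> c k" for k
      using nonneg[of "exp (of_int (k + 1))"] by (simp add: c_def ln_ge_iff pos)
    moreover have "K < of_int (\<lceil>K\<rceil> + 1)" by linarith
    ultimately show ?thesis by (meson less_le_trans)
  qed
  have lower: "\<exists>k. c k < K" for K
  proof -
    obtain x where x: "0 < x" "a x < exp K / 2" using small[of "exp K / 2"] by auto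
    \<comment> \<open>The bound \<open>ln x\<close> keeps the first summand below
      \<open>exp K / 2\<close>; the bound \<open>K - 2\<close> does the same for the second one
      because \<open>exp 2 > 2\<close>.\<close>
    define k where "k = \<lfloor>min (ln x) (K - 2)\<rfloor> - 1"
    have k: "of_int (k + 1) \<le> ln x" "of_int (k + 1) \<le> K - 2" by (auto simp: k_def) linarith+
    have 1: "exp (of_int (k + 1)) \<le> x" using k(1) x(1) by (metis exp_le_cancel_iff exp_ln)
    have "exp (of_int (k + 1)) \<le> exp (K - 2)" using k(2) by simp
    also have "\<dots> < exp K / 2"
      using exp_ge_add_one_self[of 2] by (simp add: exp_diff field_simps)
    finally have "a (exp (of_int (k + 1))) + exp (of_int (k + 1)) < exp K"
      using mono[OF _ 1] x(2) by simp
    then have "c k < ln (exp K)" unfolding c_def ln_less_cancel_iff[OF pos exp_gt_zero] .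
    then have "c k < K" by simp
    then show ?thesis ..
  qed
  have inc: "c k < c (k + 1)" for k
    unfolding c_def ln_less_cancel_iff[OF pos pos] by (intro add_le_less_mono mono) auto
  obtain \<beta> where \<beta>: "order_bij \<beta>" "\<And>z. c \<lfloor>z\<rfloor> \<le> \<beta> z"
    using interpolation_order_bij[OF inc lower upper] by blast
  define \<eta> where "\<eta> x = (if x \<le> 0 then x else exp (\<beta> (ln x)))" for x
  have "strict_mono \<eta>"
  proof (rule strict_monoI)
    fix x y :: real assume "x < y"
    then show "\<eta> x < \<eta> y"
      using \<beta>(1) le_less_trans[OF _ exp_gt_zero, of x]
      by (auto simp: \<eta>_def order_bij_def strict_mono_less)
  qed
  moreover have "surj \<eta>"
  proof (unfold surj_def, rule allI)
    fix y :: real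
    show "\<exists>x. y = \<eta> x"
    proof (cases "y \<le> 0")
      case True then show ?thesis by (intro exI[of _ y]) (simp add: \<eta>_def)
    next
      case False
      then show ?thesis
        using order_bij_inv(3)[OF \<beta>(1)] by (intro exI[of _ "exp (inv \<beta> (ln y))"]) (simp add: \<eta>_def)
    qed
  qed
  moreover have "a x < \<eta> x" if x: "0 < x" for x
  proof -
    have "ln x \<le> of_int (\<lfloor>ln x\<rfloor> + 1)" by linarith
    then have "x \<le> exp (of_int (\<lfloor>ln x\<rfloor> + 1))" using x by (metis exp_le_cancel_iff exp_ln)
    from mono[OF x this] have "a x < a (exp (of_int (\<lfloor>ln x\<rfloor> + 1))) + exp (of_int (\<lfloor>ln x\<rfloor> + 1))"
      using exp_gt_zero[of "of_int (\<lfloor>ln x\<rfloor> + 1)"] by linarith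
    also have "\<dots> = exp (c \<lfloor>ln x\<rfloor>)" unfolding c_def by (simp add: pos)
    also have "\<dots> \<le> \<eta> x" using \<beta>(2)[of "ln x"] x by (simp add: \<eta>_def)
    finally show ?thesis .
  qed
  ultimately show ?thesis using that[of \<eta>] by (simp add: order_bij_def \<eta>_def)
qed

text \<open>The odds map \<open>y / (1 - y)\<close>, with inverse \<open>u / (1 + u)\<close>,
  identifies the open unit interval with the positive half-line. Conjugating \<open>h\<close> by it
  and extending by the identity gives the bijection.\<close>

lemma odds_order_bij:
  assumes h: "order_bij h" "h 0 = 0"
  shows "order_bij (\<lambda>y. if y \<le> 0 \<or> 1 \<le> y then y else h (y / (1 - y)) / (1 + h (y / (1 - y))))"
    (is "order_bij ?\<theta>")
proof -
  have less: "h a < h b \<longleftrightarrow> a < b" for a b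
    using h(1) by (simp add: order_bij_def strict_mono_less)
  have pos: "0 < h a \<longleftrightarrow> 0 < a" for a using less[of 0 a] h(2) by simp
  have frac_less: "u / (1 + u) < v / (1 + v)" if "0 < u" "u < v" for u v :: real
    using that by (simp add: field_simps)
  have odds_less: "u / (1 - u) < v / (1 - v)" if "0 < u" "u < v" "v < 1" for u v :: real
    using that by (simp add: field_simps)
  have unit: "0 < ?\<theta> y" "?\<theta> y < 1" if "0 < y" "y < 1" for y
  proof -
    have "0 < h (y / (1 - y))" using that by (simp add: pos)
    then show "0 < ?\<theta> y" "?\<theta> y < 1" using that by (auto simp: field_simps)
  qed
  have "strict_mono ?\<theta>"
  proof (rule strict_monoI)
    fix x y :: real assume xy: "x < y"
    consider "x \<le> 0 \<or> 1 \<le> x" | "0 < x" "x < 1" "1 \<le> y" | "0 < x" "y < 1" by linarith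
    then show "?\<theta> x < ?\<theta> y"
    proof cases
      case 1
      then show ?thesis using xy unit(1)[of y] by (cases "y < 1") auto
    next
      case 2
      then show ?thesis using unit(2)[of x] by simp
    next
      case 3
      have "h (x / (1 - x)) / (1 + h (x / (1 - x))) < h (y / (1 - y)) / (1 + h (y / (1 - y)))"
        using 3 xy by (intro frac_less) (auto simp: pos less odds_less)
      then show ?thesis using 3 xy by simp
    qed
  qed
  moreover have "surj ?\<theta>"
    unfolding surj_def
  proof
    fix y :: real
    show "\<exists>x. y = ?\<theta> x"
    proof (cases "y \<le> 0 \<or> 1 \<le> y")
      case True
      then show ?thesis by (intro exI[of _ y]) simp
    next
      case False
      define z where "z = inv h (y / (1 - y))"
      have hz: "h z = y / (1 - y)" by (simp add: z_def order_bij_inv[OF h(1)])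
      then have z: "0 < z" using False pos[of z] by simp
      have "z / (1 + z) / (1 - z / (1 + z)) = z" using z by (simp add: field_simps)
      moreover have "h z / (1 + h z) = y" using False by (simp add: hz field_simps)
      moreover have "\<not> (z / (1 + z) \<le> 0 \<or> 1 \<le> z / (1 + z))" using z by (simp add: field_simps)
      ultimately show ?thesis by (intro exI[of _ "z / (1 + z)"]) simp
    qed
  qed
  ultimately show ?thesis by (simp add: order_bij_def)
qed

text \<open>First \<open>\<eta>\<close> is chosen with \<open>\<Phi> (\<eta> x) x \<le> w x\<close>.
  If \<open>t \<le> \<eta> x\<close>, the bound is \<open>\<theta> 1 = 1\<close>. Otherwise put
  \<open>r = t - \<eta> x\<close>: antitonicity gives
  \<open>\<Phi> t x \<le> min (w x) (\<Phi> r x)\<close>, whose supremum \<open>N r\<close> over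
  \<open>x\<close> depends on \<open>r\<close> only, and \<open>\<theta>\<close> is chosen with
  \<open>N r \<le> \<theta> (exp (- r))\<close>.\<close>

lemma dominating_scale_change:
  fixes \<Phi> :: "real \<Rightarrow> real \<Rightarrow> real"
  assumes bnd: "\<And>t x. 0 \<le> \<Phi> t x" "\<And>t x. \<Phi> t x \<le> 1"
    and anti: "\<And>s t x. s \<le> t \<Longrightarrow> \<Phi> t x \<le> \<Phi> s x"
    and mono: "\<And>t x y. x \<le> y \<Longrightarrow> \<Phi> t x \<le> \<Phi> t y"
    and large: "\<And>x e. 0 < e \<Longrightarrow> \<exists>t>0. \<Phi> t x \<le> e"
    and small: "\<And>t. 0 < t \<Longrightarrow> \<exists>x>0. \<Phi> t x < 1"
  obtains \<theta> \<eta> where "scale_change \<theta> \<eta>"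
    "\<And>t x. 0 < t \<Longrightarrow> 0 < x \<Longrightarrow> \<Phi> t x \<le> \<theta> (exp (- max 0 (t - \<eta> x)))"
proof -
  \<comment> \<open>Any decreasing \<open>w\<close> with limits 1 at 0 and 0 at infinity would do.\<close>
  define w where "w x = 1 / (1 + x)" for x :: real
  have w: "0 < w x" "w x < 1" if "0 < x" for x using that by (auto simp: w_def)
  have w_anti: "w y \<le> w x" if "0 < x" "x \<le> y" for x y using that by (simp add: w_def frac_le)

  define A where "A x = {t. 0 < t \<and> \<Phi> t x \<le> w x}" for x
  define a where "a x = Inf (A x)" for x
  have A: "A x \<noteq> {}" if "0 < x" for x using large[OF w(1)[OF that], of x] by (auto simp: A_def)
  have A_bdd: "bdd_below (A x)" for x by (auto simp: A_def intro!: bdd_belowI[of _ 0])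
  obtain \<eta> where \<eta>: "order_bij \<eta>" "\<eta> 0 = 0" "\<And>x. 0 < x \<Longrightarrow> a x < \<eta> x"
  proof (rule order_bij_dominating)
    fix x :: real assume x: "0 < x"
    show "0 \<le> a x" unfolding a_def by (rule cInf_greatest[OF A[OF x]]) (auto simp: A_def)
    fix y assume y: "x \<le> y"
    have "A y \<subseteq> A x"
      using mono[OF y] w_anti[OF x y] by (auto simp: A_def intro: order_trans)
    then show "a x \<le> a y" unfolding a_def using A A_bdd x y by (intro cInf_superset_mono) auto
  next
    fix e :: real assume e: "0 < e"
    then obtain x0 where x0: "0 < x0" "\<Phi> (e / 2) x0 < 1" using small[of "e / 2"] by auto
    define q where "q = \<Phi> (e / 2) x0"
    \<comment> \<open>With \<open>x \<le> 1 - q\<close> one gets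
      \<open>q * (1 + x) \<le> 1 - (1 - q)\<^sup>2 \<le> 1\<close>, that is
      \<open>q \<le> w x\<close>.\<close>
    define x where "x = min x0 (1 - q)"
    have x: "0 < x" "x \<le> x0" "x \<le> 1 - q" using x0 by (auto simp: x_def q_def)
    have "0 \<le> q" by (simp add: q_def bnd)
    have "q * (1 + x) \<le> q * (1 + (1 - q))" using x \<open>0 \<le> q\<close> by (intro mult_left_mono) auto
    also have "\<dots> = 1 - (1 - q)\<^sup>2" by (simp add: power2_eq_square algebra_simps)
    also have "\<dots> \<le> 1" by simp
    finally have "q \<le> w x" using x(1) by (simp add: w_def field_simps)
    moreover have "\<Phi> (e / 2) x \<le> q" unfolding q_def using x(2) by (rule mono)
    ultimately have "e / 2 \<in> A x" using e by (simp add: A_def)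
    then have "a x \<le> e / 2" unfolding a_def using A_bdd by (rule cInf_lower)
    then show "\<exists>x>0. a x < e" using x(1) e by (intro exI[of _ x]) auto
  qed blast
  have \<eta>_w: "\<Phi> (\<eta> x) x \<le> w x" if x: "0 < x" for x
  proof -
    obtain t where "t \<in> A x" "t < \<eta> x" using cInf_lessD[OF A[OF x]] \<eta>(3)[OF x] by (auto simp: a_def)
    then show ?thesis using anti[of t "\<eta> x" x] by (auto simp: A_def)
  qed

  \<comment> \<open>The cap \<open>w x\<close> controls large \<open>x\<close>, where
    \<open>\<Phi> r x\<close> may approach 1; without it the supremum could be 1.\<close>
  define N where "N r = Sup ((\<lambda>x. min (w x) (\<Phi> r x)) ` {0<..})" for r
  have N_bdd: "bdd_above ((\<lambda>x. min (w x) (\<Phi> r x)) ` {0<..})" for r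
    by (rule bdd_aboveI[of _ 1]) (auto simp: bnd min.coboundedI2)
  have N_upper: "min (w x) (\<Phi> r x) \<le> N r" if "0 < x" for r x
    unfolding N_def using that by (intro cSup_upper N_bdd) auto
  have N_least: "N r \<le> c" if "\<And>x. 0 < x \<Longrightarrow> min (w x) (\<Phi> r x) \<le> c" for r c
    unfolding N_def by (rule cSup_least) (use that in \<open>auto intro: exI[of _ 1]\<close>)
  \<comment> \<open>Up to \<open>X\<close> the second entry of the minimum is at most
    \<open>\<Phi> r X\<close>, beyond \<open>X\<close> the first is at most \<open>w X\<close>.
    Suitable \<open>X\<close> give both \<open>N r < 1\<close> and the smallness of \<open>N\<close>
    for large \<open>r\<close>.\<close>
  have N_split: "N r \<le> max (w X) (\<Phi> r X)" if "0 < X" for r X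
  proof (rule N_least)
    fix x :: real assume "0 < x"
    then show "min (w x) (\<Phi> r x) \<le> max (w X) (\<Phi> r X)"
      using mono[of x X r] w_anti[OF that, of x] by (cases "x \<le> X") (auto simp: min_def max_def)
  qed
  have N_nonneg: "0 \<le> N r" for r
    using N_upper[of 1 r] w(1)[of 1] bnd(1)[of r 1] by (auto simp: min_def split: if_splits)
  have N_less_1: "N r < 1" if "0 < r" for r
    using small[OF that] N_split w(2) by (meson le_less_trans max_less_iff_conj)
  have N_anti: "N s \<le> N r" if "r \<le> s" for r s
    by (rule N_least, rule order_trans[OF _ N_upper]) (use anti[OF that] in \<open>auto simp: min_le_iff_disj\<close>)
  have N_small: "\<exists>r>0. N r \<le> e" if e: "0 < e" for e
  proof -
    have "w (1 / e) \<le> e" using e by (simp add: w_def field_simps)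
    moreover obtain r where "0 < r" "\<Phi> r (1 / e) \<le> e" using large[OF e] by blast
    ultimately show ?thesis using N_split[of "1 / e" r] e by (intro exI[of _ r]) auto
  qed

  define g where "g u = u / (1 - u)" for u :: real
  have g_mono: "g u \<le> g v" if "u \<le> v" "v < 1" for u v
    using that by (simp add: g_def field_simps)
  \<comment> \<open>If \<open>x\<close> is the odds of \<open>exp (- r)\<close>, then
    \<open>1 + 1 / x = exp r\<close>. So \<open>b\<close> maps the odds of \<open>exp (- r)\<close>
    to the odds of \<open>N r\<close>, and a majorant of \<open>b\<close> is the required
    \<open>\<theta>\<close> in odds coordinates.\<close>
  define b where "b x = g (N (ln (1 + 1 / x)))" for x
  have ln_pos: "0 < ln (1 + 1 / x)" if "0 < x" for x :: real using that by (intro ln_gt_zero) simp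
  obtain h where h: "order_bij h" "h 0 = 0" "\<And>x. 0 < x \<Longrightarrow> b x < h x"
  proof (rule order_bij_dominating)
    fix x :: real assume x: "0 < x"
    show "0 \<le> b x" using N_nonneg N_less_1[OF ln_pos[OF x]] by (simp add: b_def g_def)
    fix y assume "x \<le> y"
    then have "ln (1 + 1 / y) \<le> ln (1 + 1 / x)" using x by (simp add: frac_le add_pos_pos)
    then show "b x \<le> b y"
      unfolding b_def using \<open>x \<le> y\<close> x by (intro g_mono N_anti N_less_1 ln_pos) auto
  next
    fix e :: real assume e: "0 < e"
    \<comment> \<open>The solution of \<open>g d = e / 2\<close>.\<close>
    define d where "d = e / (2 + e)"
    have d: "0 < d" "d < 1" using e by (auto simp: d_def)
    have "g d = e / 2" using e by (simp add: d_def g_def field_simps)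
    then have "g d < e" using e by simp
    obtain r where r: "0 < r" "N r \<le> d" using N_small[OF d(1)] by blast
    define x where "x = 1 / (exp r - 1)"
    have x: "0 < x" "ln (1 + 1 / x) = r" using r by (auto simp: x_def)
    have "b x \<le> g d" unfolding b_def x(2) using r(2) d(2) by (rule g_mono)
    then show "\<exists>x>0. b x < e" using x(1) \<open>g d < e\<close> by (intro exI[of _ x]) auto
  qed blast
  define \<theta> where "\<theta> y = (if y \<le> 0 \<or> 1 \<le> y then y else h (y / (1 - y)) / (1 + h (y / (1 - y))))" for y
  have N_\<theta>: "N r \<le> \<theta> (exp (- r))" if r: "0 < r" for r
  proof -
    define x where "x = exp (- r) / (1 - exp (- r))"
    have x: "0 < x" using r by (simp add: x_def)
    have "1 + 1 / x = exp r" using r by (simp add: x_def field_simps exp_minus)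
    then have "b x = g (N r)" by (simp add: b_def)
    then have hx: "g (N r) \<le> h x" using h(3)[OF x] by simp
    have g0: "0 \<le> g (N r)" using N_nonneg[of r] N_less_1[OF r] by (simp add: g_def)
    have "N r = g (N r) / (1 + g (N r))" using N_less_1[OF r] by (simp add: g_def field_simps)
    also have "\<dots> \<le> h x / (1 + h x)" using hx g0 by (simp add: field_simps)
    also have "\<dots> = \<theta> (exp (- r))" using r by (simp add: \<theta>_def x_def)
    finally show ?thesis .
  qed
  have "scale_change \<theta> \<eta>"
    by unfold_locales (use odds_order_bij[OF h(1,2)] \<eta> in \<open>auto simp: \<theta>_def [abs_def]\<close>)
  moreover have "\<Phi> t x \<le> \<theta> (exp (- max 0 (t - \<eta> x)))" if "0 < t" "0 < x" for t x
  proof (cases "t \<le> \<eta> x")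
    case True
    then show ?thesis by (simp add: \<theta>_def bnd max_def)
  next
    case False
    have "0 < \<eta> x" using \<eta>(1,2) that(2) by (metis order_bij_def strict_monoD)
    then have "\<Phi> t x \<le> \<Phi> (t - \<eta> x) x" by (intro anti) simp
    moreover have "\<Phi> t x \<le> w x" using anti[of "\<eta> x" t x] \<eta>_w[OF that(2)] False by linarith
    ultimately have "\<Phi> t x \<le> N (t - \<eta> x)" using N_upper[OF that(2), of "t - \<eta> x"] by linarith
    also have "\<dots> \<le> \<theta> (exp (- (t - \<eta> x)))" using False by (intro N_\<theta>) simp
    finally show ?thesis using False by (simp add: max_def)
  qed
  ultimately show ?thesis using that by blast
qed

subsection \<open>Finite-dimensional subspaces of Archimedean PN spaces\<close>

text \<open>The Bolzano-Weierstrass theorem one coordinate at a time: each induction step thins the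
  subsequence once more, which keeps the limits already found.\<close>

lemma bounded_coords_convergent_subseq:
  fixes \<alpha> :: "nat \<Rightarrow> nat \<Rightarrow> real"
  assumes "\<And>k i. i < n \<Longrightarrow> \<bar>\<alpha> k i\<bar> \<le> B"
  shows "\<exists>r l. strict_mono (r :: nat \<Rightarrow> nat) \<and> (\<forall>i<n. (\<lambda>k. \<alpha> (r k) i) \<longlonglongrightarrow> l i)"
  using assms
proof (induction n)
  case 0
  then show ?case by (auto intro: exI[of _ id] simp: strict_mono_def)
next
  case (Suc n)
  then obtain r l where r: "strict_mono (r :: nat \<Rightarrow> nat)" "\<forall>i<n. (\<lambda>k. \<alpha> (r k) i) \<longlonglongrightarrow> l i"
    by (metis less_SucI)
  have "\<alpha> (r k) n \<in> {-B..B}" for k using Suc.prems[of n "r k"] by (auto simp: abs_le_iff)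
  moreover have "seq_compact {-B..B}" by (simp add: compact_imp_seq_compact)
  ultimately obtain m s where s: "strict_mono s" "((\<lambda>k. \<alpha> (r k) n) \<circ> s) \<longlonglongrightarrow> m"
    by (metis seq_compactE)
  have "(\<lambda>k. \<alpha> ((r \<circ> s) k) i) \<longlonglongrightarrow> (l(n := m)) i" if "i < Suc n" for i
  proof (cases "i = n")
    case True
    then show ?thesis using s(2) by (simp add: o_def)
  next
    case False
    then have "(\<lambda>k. \<alpha> (r k) i) \<longlonglongrightarrow> l i" using r(2) that by simp
    from LIMSEQ_subseq_LIMSEQ[OF this s(1)] show ?thesis using False by (simp add: o_def)
  qed
  then show ?case using strict_mono_o[OF r(1) s(1)] by blast
qed

text \<open>\<open>independent\<close> speaks about sets of vectors, so the coefficients are carried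
  over along the inverse of the injective family \<open>p\<close>.\<close>

lemma independent_comb_nonzero:
  fixes p :: "nat \<Rightarrow> 'v::real_vector"
  assumes "inj_on p {..<n}" "independent (p ` {..<n})" "(\<Sum>i<n. \<bar>\<alpha> i\<bar>) > 0"
  shows "(\<Sum>i<n. \<alpha> i *\<^sub>R p i) \<noteq> 0"
proof
  assume 0: "(\<Sum>i<n. \<alpha> i *\<^sub>R p i) = 0"
  let ?u = "\<lambda>v. \<alpha> (inv_into {..<n} p v)"
  have "(\<Sum>v\<in>p ` {..<n}. ?u v *\<^sub>R v) = (\<Sum>i<n. \<alpha> i *\<^sub>R p i)"
    by (subst sum.reindex[OF assms(1)]) (auto intro!: sum.cong simp: inv_into_f_f[OF assms(1)])
  then have "?u (p i) = 0" if "i < n" for i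
    using independentD[OF assms(2), of "p ` {..<n}" ?u "p i"] 0 that by auto
  then have "\<alpha> i = 0" if "i < n" for i using that inv_into_f_f[OF assms(1)] by simp
  then show False using assms(3) by simp
qed

locale archimedean_PN =
  fixes \<nu> :: "'v::real_vector \<Rightarrow> df" and T Ts
  assumes PN: "PN_space \<nu> T Ts" and arch: "archimedean_tf Ts" and not_epsInf: "\<And>q. \<nu> q \<noteq> epsInf"
begin

lemma in_DeltaPlus [simp]: "\<nu> q \<in> DeltaPlus"
  and norm_eq_eps0: "\<nu> q = eps0 \<longleftrightarrow> q = 0"
  and norm_minus: "\<nu> (- q) = \<nu> q"
  and norm_add: "df_le (T (\<nu> q) (\<nu> q')) (\<nu> (q + q'))"
  and norm_split: "l \<in> {0..1} \<Longrightarrow> df_le (\<nu> q) (Ts (\<nu> (l *\<^sub>R q)) (\<nu> ((1 - l) *\<^sub>R q)))"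
  and T: "triangle_function T" "continuous_tf T"
  and Ts: "triangle_function Ts" "continuous_tf Ts"
  using PN unfolding PN_space_def by (elim conjE, (simp; fail)+)

section \<open>Behaviour of the norm along a ray\<close>

lemma norm_halves: "df_le (\<nu> q) (Ts (\<nu> ((1 / 2) *\<^sub>R q)) (\<nu> ((1 / 2) *\<^sub>R q)))"
  using norm_split[of "1 / 2" q] by simp

text \<open>By (N4) and \<open>triangle_le_left\<close>, the norm of \<open>q\<close> lies below
  that of its part \<open>l *\<^sub>R q\<close>; negative factors follow from (N2).\<close>

lemma norm_contract:
  assumes "\<bar>l\<bar> \<le> 1"
  shows "df_le (\<nu> q) (\<nu> (l *\<^sub>R q))"
proof -
  have *: "df_le (\<nu> q) (\<nu> (l *\<^sub>R q))" if "l \<in> {0..1}" for l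
    using norm_split[OF that] triangle_le_left[OF Ts(1)] df_le_trans in_DeltaPlus by blast
  show ?thesis
  proof (cases "0 \<le> l")
    case True
    then show ?thesis using assms * by auto
  next
    case False
    then show ?thesis using assms *[of "- l"] norm_minus[of "l *\<^sub>R q"] by auto
  qed
qed

lemma norm_scale_antimono:
  assumes "\<bar>s\<bar> \<le> \<bar>t\<bar>"
  shows "df_le (\<nu> (t *\<^sub>R q)) (\<nu> (s *\<^sub>R q))"
proof (cases "t = 0")
  case True
  then show ?thesis using assms by (simp add: df_le_def)
next
  case False
  then have "\<bar>s / t\<bar> \<le> 1" using assms by (simp add: field_simps)
  from norm_contract[OF this, of "t *\<^sub>R q"] show ?thesis using False by simp
qed

text \<open>The norms \<open>?F k\<close> increase with \<open>k\<close>, and (N4) at one half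
  squeezes \<open>Ts (?F (Suc k)) (?F (Suc k))\<close> between \<open>?F k\<close> and
  \<open>?F (Suc k)\<close>. Hence \<open>archimedean_limit\<close> applies, and the limit has to be
  \<open>eps0\<close>.\<close>

lemma norm_shrink_dyadic: "\<exists>k. c < \<nu> ((1 / 2) ^ k *\<^sub>R q) (ereal x)" if "c < 1" "0 < x"
proof -
  let ?F = "\<lambda>k. \<nu> ((1 / 2) ^ k *\<^sub>R q)"
  have inc: "?F k (ereal y) \<le> ?F (Suc k) (ereal y)" for k y
    using norm_scale_antimono[of "(1 / 2) ^ Suc k" "(1 / 2) ^ k" q] by (simp add: df_le_def)
  have "\<exists>l. (\<lambda>k. ?F k (ereal y)) \<longlonglongrightarrow> l \<and> (\<forall>k. ?F k (ereal y) \<le> l)" for y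
  proof -
    have "incseq (\<lambda>k. ?F k (ereal y))" using inc by (intro incseq_SucI)
    then show ?thesis
      by (rule incseq_convergent[where B = 1]) (auto simp: DeltaPlusD)
  qed
  then obtain f where f: "\<And>y. (\<lambda>k. ?F k (ereal y)) \<longlonglongrightarrow> f y" "\<And>y k. ?F k (ereal y) \<le> f y"
    by metis
  have fS: "(\<lambda>k. ?F (Suc k) (ereal y)) \<longlonglongrightarrow> f y" for y
    using f(1) by (rule LIMSEQ_Suc)
  have "(\<lambda>k. Ts (?F (Suc k)) (?F (Suc k)) (ereal y)) \<longlonglongrightarrow> f y" for y
  proof (rule real_tendsto_sandwich[OF _ _ f(1) fS])
    show "eventually (\<lambda>k. ?F k (ereal y) \<le> Ts (?F (Suc k)) (?F (Suc k)) (ereal y)) sequentially"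
    proof (intro always_eventually allI)
      fix k
      have "(1 / 2) *\<^sub>R ((1 / 2) ^ k *\<^sub>R q) = (1 / 2) ^ Suc k *\<^sub>R q" by simp
      from norm_halves[of "(1 / 2) ^ k *\<^sub>R q", unfolded this]
      show "?F k (ereal y) \<le> Ts (?F (Suc k)) (?F (Suc k)) (ereal y)"
        unfolding df_le_def ..
    qed
    show "eventually (\<lambda>k. Ts (?F (Suc k)) (?F (Suc k)) (ereal y) \<le> ?F (Suc k) (ereal y)) sequentially"
      using triangle_le_left[OF Ts(1) in_DeltaPlus in_DeltaPlus]
      unfolding df_le_def by (intro always_eventually allI) blast
  qed
  then obtain L where L: "L = eps0 \<or> L = epsInf" "\<And>y. L (ereal y) \<le> f y" "\<And>y z. y < z \<Longrightarrow> f y \<le> L (ereal z)"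
    using archimedean_limit[OF Ts arch, of "\<lambda>k. ?F (Suc k)" f] fS by auto
  \<comment> \<open>The limit lies above the norm of \<open>q\<close>, which is positive at some
    real argument; this rules out \<open>epsInf\<close>.\<close>
  obtain z where "0 < \<nu> q (ereal z)" using not_epsInfE[OF in_DeltaPlus not_epsInf] by blast
  then have "0 < L (ereal (z + 1))" using f(2)[of 0 z] L(3)[of z "z + 1"] by simp
  then have "L = eps0" using L(1) by auto
  then have "c < f x" using L(2)[of x] that by simp
  then have "eventually (\<lambda>k. c < ?F k (ereal x)) sequentially"
    using f(1) order_tendstoD(1) by blast
  then show ?thesis by (auto simp: eventually_sequentially)
qed

text \<open>The mirror image of the shrinking case: the norms decrease to an idempotent. It cannot
  be \<open>eps0\<close>, because it lies below the norm of \<open>q\<close> and would force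
  \<open>q = 0\<close>.\<close>

lemma norm_stretch_dyadic: "\<exists>k. \<nu> (2 ^ k *\<^sub>R q) (ereal x) < c" if "q \<noteq> 0" "0 < c"
proof -
  let ?F = "\<lambda>k. \<nu> (2 ^ k *\<^sub>R q)"
  have dec: "?F (Suc k) (ereal y) \<le> ?F k (ereal y)" for k y
    using norm_scale_antimono[of "2 ^ k" "2 ^ Suc k" q] by (simp add: df_le_def)
  have "\<exists>l. (\<lambda>k. ?F k (ereal y)) \<longlonglongrightarrow> l \<and> (\<forall>k. l \<le> ?F k (ereal y))" for y
  proof -
    have "decseq (\<lambda>k. ?F k (ereal y))" using dec by (intro decseq_SucI)
    then show ?thesis
      by (rule decseq_convergent[where B = 0]) (auto simp: DeltaPlusD)
  qed
  then obtain f where f: "\<And>y. (\<lambda>k. ?F k (ereal y)) \<longlonglongrightarrow> f y" "\<And>y k. f y \<le> ?F k (ereal y)"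
    by metis
  have "(\<lambda>k. Ts (?F k) (?F k) (ereal y)) \<longlonglongrightarrow> f y" for y
  proof (rule real_tendsto_sandwich[OF _ _ LIMSEQ_Suc[OF f(1)] f(1)])
    show "eventually (\<lambda>k. ?F (Suc k) (ereal y) \<le> Ts (?F k) (?F k) (ereal y)) sequentially"
      using norm_halves[of "2 ^ Suc _ *\<^sub>R q"] by (simp add: df_le_def)
    show "eventually (\<lambda>k. Ts (?F k) (?F k) (ereal y) \<le> ?F k (ereal y)) sequentially"
      using triangle_le_left[OF Ts(1) in_DeltaPlus in_DeltaPlus]
      unfolding df_le_def by (intro always_eventually allI) blast
  qed
  then obtain L where L: "L = eps0 \<or> L = epsInf" "\<And>y. L (ereal y) \<le> f y" "\<And>y z. y < z \<Longrightarrow> f y \<le> L (ereal z)"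
    using archimedean_limit[OF Ts arch, of ?F f] f(1) by auto
  have "L \<noteq> eps0"
  proof
    assume "L = eps0"
    then have "1 \<le> \<nu> q (ereal y)" if "0 < y" for y
      using L(2)[of y] f(2)[of y 0] that by simp
    then show False using eps0_eqI[OF in_DeltaPlus] norm_eq_eps0 that(1) by blast
  qed
  then have "f x < c" using L(1) L(3)[of x "x + 1"] that(2) by simp
  then have "eventually (\<lambda>k. ?F k (ereal x) < c) sequentially"
    using f(1) order_tendstoD(2) by blast
  then show ?thesis by (auto simp: eventually_sequentially)
qed

section \<open>Combinations with vanishing coefficients\<close>

lemma norm_scale_tendsto_eps0:
  assumes "s \<longlonglongrightarrow> 0"
  shows "weak_conv (\<lambda>k. \<nu> (s k *\<^sub>R q)) eps0"
proof (subst weak_conv_eps0_iff, simp, intro allI impI)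
  fix x :: real assume x: "0 < x"
  show "(\<lambda>k. \<nu> (s k *\<^sub>R q) (ereal x)) \<longlonglongrightarrow> 1"
  proof (rule order_tendstoI)
    fix c :: real assume "c < 1"
    then obtain m where m: "c < \<nu> ((1 / 2) ^ m *\<^sub>R q) (ereal x)" using norm_shrink_dyadic x by blast
    have "eventually (\<lambda>k. \<bar>s k\<bar> < (1 / 2) ^ m) sequentially"
      using tendsto_rabs_zero[OF assms] by (rule order_tendstoD) simp
    then show "eventually (\<lambda>k. c < \<nu> (s k *\<^sub>R q) (ereal x)) sequentially"
    proof eventually_elim
      case (elim k)
      then show ?case
        using norm_scale_antimono[of "s k" "(1 / 2) ^ m" q] m
        by (auto simp: df_le_def intro: less_le_trans)
    qed
  next
    fix c :: real assume "1 < c"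
    then show "eventually (\<lambda>k. \<nu> (s k *\<^sub>R q) (ereal x) < c) sequentially"
      using DeltaPlusD(2)[OF in_DeltaPlus] by (intro always_eventually allI) (rule le_less_trans)
  qed
qed

text \<open>By (N3) the norm of the sum lies above a sequence that tends to
  \<open>T eps0 eps0 = eps0\<close>, by continuity of \<open>T\<close>.\<close>

lemma norm_add_tendsto_eps0:
  assumes "weak_conv (\<lambda>k. \<nu> (a k)) eps0" "weak_conv (\<lambda>k. \<nu> (b k)) eps0"
  shows "weak_conv (\<lambda>k. \<nu> (a k + b k)) eps0"
proof -
  have "weak_conv (\<lambda>k. T (\<nu> (a k)) (\<nu> (b k))) (T eps0 eps0)"
    by (rule continuous_tfD[OF T(2)]) (use assms in simp_all)
  then have "weak_conv (\<lambda>k. T (\<nu> (a k)) (\<nu> (b k))) eps0"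
    using triangle_functionD(5)[OF T(1), of eps0 eps0] by simp
  then have "\<forall>x>0. (\<lambda>k. T (\<nu> (a k)) (\<nu> (b k)) (ereal x)) \<longlonglongrightarrow> 1"
    by (subst (asm) weak_conv_eps0_iff) (simp_all add: triangle_functionD(1)[OF T(1)])
  then show ?thesis
  proof (subst weak_conv_eps0_iff, simp, intro allI impI)
    fix x :: real assume "0 < x" and *: "\<forall>x>0. (\<lambda>k. T (\<nu> (a k)) (\<nu> (b k)) (ereal x)) \<longlonglongrightarrow> 1"
    show "(\<lambda>k. \<nu> (a k + b k) (ereal x)) \<longlonglongrightarrow> 1"
      by (rule real_tendsto_sandwich[OF _ _ *[rule_format, OF \<open>0 < x\<close>] tendsto_const])
         (use norm_add in \<open>auto simp: df_le_def DeltaPlusD\<close>)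
  qed
qed

lemma norm_comb_tendsto_eps0:
  fixes p :: "nat \<Rightarrow> 'v"
  assumes "\<And>i. i < n \<Longrightarrow> (\<lambda>k. \<gamma> k i) \<longlonglongrightarrow> 0"
  shows "weak_conv (\<lambda>k. \<nu> (\<Sum>i<n. \<gamma> k i *\<^sub>R p i)) eps0"
  using assms
proof (induction n)
  case 0
  then show ?case using norm_eq_eps0[of 0] weak_conv_const[of eps0] by simp
next
  case (Suc n)
  then show ?case by (auto intro!: norm_add_tendsto_eps0 norm_scale_tendsto_eps0)
qed

section \<open>Uniform estimates over all coefficient vectors\<close>

text \<open>Counterexamples with growing coefficient sums, divided by these sums, accumulate at a
  nonzero combination \<open>?q\<close>. Each multiple of \<open>?q\<close> is approximated by
  shrunken counterexamples, whose norms stay above \<open>e\<close>; this contradicts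
  \<open>norm_stretch_dyadic\<close>.\<close>

lemma norm_comb_vanishes_at_infinity:
  fixes p :: "nat \<Rightarrow> 'v"
  assumes inj: "inj_on p {..<n}" and ind: "independent (p ` {..<n})" and e: "0 < e"
  shows "\<exists>t>0. \<forall>\<alpha>. t \<le> (\<Sum>i<n. \<bar>\<alpha> i\<bar>) \<longrightarrow> \<nu> (\<Sum>i<n. \<alpha> i *\<^sub>R p i) (ereal x) \<le> e"
proof (rule ccontr)
  assume "\<not> ?thesis"
  then have "\<exists>\<alpha>. t \<le> (\<Sum>i<n. \<bar>\<alpha> i\<bar>) \<and> e < \<nu> (\<Sum>i<n. \<alpha> i *\<^sub>R p i) (ereal x)" if "0 < t" for t
    using that by (meson not_le)
  then have "\<exists>\<alpha>. real k + 1 \<le> (\<Sum>i<n. \<bar>\<alpha> i\<bar>) \<and> e < \<nu> (\<Sum>i<n. \<alpha> i *\<^sub>R p i) (ereal x)" for k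
    by (simp add: add_nonneg_pos)
  then obtain \<alpha> where \<alpha>: "\<And>k. real k + 1 \<le> (\<Sum>i<n. \<bar>\<alpha> k i\<bar>)"
    "\<And>k. e < \<nu> (\<Sum>i<n. \<alpha> k i *\<^sub>R p i) (ereal x)"
    by metis
  define N where "N k = (\<Sum>i<n. \<bar>\<alpha> k i\<bar>)" for k
  have N: "real k + 1 \<le> N k" "0 < N k" for k using \<alpha>(1)[of k] by (auto simp: N_def)
  define \<beta> where "\<beta> k i = \<alpha> k i / N k" for k i
  have sum\<beta>: "(\<Sum>i<n. \<bar>\<beta> k i\<bar>) = 1" for k
    using N(2)[of k] by (simp add: \<beta>_def N_def flip: sum_divide_distrib)
  have "\<bar>\<beta> k i\<bar> \<le> 1" if "i < n" for k i
    unfolding sum\<beta>[of k, symmetric] using that by (intro member_le_sum[where f = "\<lambda>i. \<bar>\<beta> k i\<bar>"]) auto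
  then obtain r b where r: "strict_mono r" "\<And>i. i < n \<Longrightarrow> (\<lambda>k. \<beta> (r k) i) \<longlonglongrightarrow> b i"
    using bounded_coords_convergent_subseq[of n \<beta> 1] by blast
  have "(\<lambda>k. \<Sum>i<n. \<bar>\<beta> (r k) i\<bar>) \<longlonglongrightarrow> (\<Sum>i<n. \<bar>b i\<bar>)"
    using r(2) by (intro tendsto_sum tendsto_rabs) auto
  then have "(\<Sum>i<n. \<bar>b i\<bar>) = 1" by (simp add: sum\<beta> LIMSEQ_const_iff)
  then have nz: "(\<Sum>i<n. b i *\<^sub>R p i) \<noteq> 0" (is "?q \<noteq> 0")
    by (intro independent_comb_nonzero[OF inj ind]) simp
  have x: "0 < x" using \<alpha>(2)[of 0] e DeltaPlus_nonpos[OF in_DeltaPlus, of "ereal x"] by fastforce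
  have e1: "e \<le> 1" using \<alpha>(2)[of 0] DeltaPlusD(2)[OF in_DeltaPlus] by (meson less_imp_le less_le_trans)
  \<comment> \<open>A fixed minorant of the norms of the shrunken combinations, to which continuity of \<open>T\<close> is applied.\<close>
  define H where "H = df_of (\<lambda>y. if y \<le> x then 0 else e)"
  have H: "H \<in> DeltaPlus"
    unfolding H_def
  proof (rule df_of_in_DeltaPlus)
    fix y c :: real assume "c < (if y \<le> x then 0 else e)" "0 \<le> c"
    then have "x < y" "c < e" by (auto split: if_splits)
    then show "\<exists>z<y. c < (if z \<le> x then 0 else e)"
      using dense[of x y] by (metis not_le)
  qed (use x e e1 in auto)
  \<comment> \<open>The argument \<open>x + 1\<close> replaces \<open>x\<close> because the
    left-continuous step \<open>H\<close> takes the value \<open>e\<close> only beyond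
    \<open>x\<close>.\<close>
  have "e \<le> \<nu> (2 ^ m *\<^sub>R ?q) (ereal (x + 1))" for m
  proof -
    define s :: real where "s = 2 ^ m"
    have s: "0 < s" by (simp add: s_def)
    \<comment> \<open>The shift makes the coefficient sum at least \<open>s\<close>, so that passing
      from the counterexample to the scale \<open>s\<close> is a contraction.\<close>
    define R where "R k = r (k + nat \<lceil>s\<rceil>)" for k
    have R: "s \<le> N (R k)" for k
    proof -
      have "s \<le> real (k + nat \<lceil>s\<rceil>)" using s by linarith
      also have "\<dots> \<le> real (R k)" unfolding R_def by (rule of_nat_mono[OF seq_suble[OF r(1)]])
      also have "\<dots> \<le> N (R k)" using N(1)[of "R k"] by simp
      finally show ?thesis .
    qed
    have "df_le H (\<nu> (s *\<^sub>R ?q))"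
    proof (rule weak_conv_le)
      let ?d = "\<lambda>k. \<Sum>i<n. (s * (b i - \<beta> (R k) i)) *\<^sub>R p i"
      have "(\<lambda>k. s * (b i - \<beta> (R k) i)) \<longlonglongrightarrow> 0" if "i < n" for i
      proof -
        have "(\<lambda>k. s * (b i - \<beta> (R k) i)) \<longlonglongrightarrow> s * (b i - b i)"
          unfolding R_def using LIMSEQ_ignore_initial_segment[OF r(2)[OF that]]
          by (intro tendsto_intros)
        then show ?thesis by simp
      qed
      then have "weak_conv (\<lambda>k. \<nu> (?d k)) eps0" by (rule norm_comb_tendsto_eps0)
      then have "weak_conv (\<lambda>k. T H (\<nu> (?d k))) (T H eps0)"
        by (intro continuous_tfD[OF T(2)] weak_conv_const) (simp_all add: H)
      then show "weak_conv (\<lambda>k. T H (\<nu> (?d k))) H"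
        using triangle_functionD(5)[OF T(1) H H] by simp
      show "weak_conv (\<lambda>k. \<nu> (s *\<^sub>R ?q)) (\<nu> (s *\<^sub>R ?q))" by (rule weak_conv_const)
      fix k y
      let ?c = "\<Sum>i<n. \<alpha> (R k) i *\<^sub>R p i" and ?l = "s / N (R k)"
      have l: "\<bar>?l\<bar> \<le> 1" using R[of k] N(2)[of "R k"] s by simp
      have "df_le H (\<nu> (?l *\<^sub>R ?c))"
      proof (rule df_le_DeltaPlusI[OF H in_DeltaPlus])
        fix y
        have "e \<le> \<nu> (?l *\<^sub>R ?c) (ereal y)" if "x < y"
          using \<alpha>(2)[of "R k"] norm_contract[OF l, of ?c] DeltaPlus_mono[OF in_DeltaPlus[of "?l *\<^sub>R ?c"], of x y] that
          by (simp add: df_le_def) (meson less_imp_le order_trans)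
        then show "H (ereal y) \<le> \<nu> (?l *\<^sub>R ?c) (ereal y)" by (simp add: H_def DeltaPlusD)
      qed
      then have "df_le (T H (\<nu> (?d k))) (T (\<nu> (?l *\<^sub>R ?c)) (\<nu> (?d k)))"
        by (rule triangle_functionD(4)[OF T(1) H in_DeltaPlus in_DeltaPlus])
      \<comment> \<open>The contracted counterexample has coefficients
        \<open>s * \<beta> (R k) i\<close>, and \<open>?d k\<close> supplies the difference to
        \<open>s * b i\<close>.\<close>
      moreover have "?l *\<^sub>R ?c + ?d k = s *\<^sub>R ?q"
        by (simp add: scaleR_sum_right \<beta>_def algebra_simps flip: sum.distrib)
      ultimately show "T H (\<nu> (?d k)) (ereal y) \<le> \<nu> (s *\<^sub>R ?q) (ereal y)"
        using norm_add[of "?l *\<^sub>R ?c" "?d k"] by (auto simp: df_le_def intro: order_trans)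
    qed (simp_all add: H)
    then have "H (ereal (x + 1)) \<le> \<nu> (s *\<^sub>R ?q) (ereal (x + 1))" by (simp add: df_le_def)
    then show ?thesis by (simp add: H_def s_def)
  qed
  then show False using norm_stretch_dyadic[OF nz e] by (meson not_le)
qed

text \<open>Counterexamples shrunk to coefficient sum exactly \<open>t\<close> have norms tending to
  \<open>eps0\<close>. A subsequence of their coefficients converges, and adding the vanishing
  difference gives the limit combination the norm \<open>eps0\<close>, although it is
  nonzero.\<close>

lemma norm_comb_away_from_eps0:
  fixes p :: "nat \<Rightarrow> 'v"
  assumes inj: "inj_on p {..<n}" and ind: "independent (p ` {..<n})" and t: "0 < t"
  shows "\<exists>x>0. \<exists>c<1. \<forall>\<alpha>. t \<le> (\<Sum>i<n. \<bar>\<alpha> i\<bar>) \<longrightarrow> \<nu> (\<Sum>i<n. \<alpha> i *\<^sub>R p i) (ereal x) \<le> c"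
proof (rule ccontr)
  assume contr: "\<not> ?thesis"
  define d where "d k = 1 / (real k + 1)" for k :: nat
  have d: "0 < d k" for k by (simp add: d_def)
  have d0: "d \<longlonglongrightarrow> 0" unfolding d_def using LIMSEQ_inverse_real_of_nat by (simp add: inverse_eq_divide add.commute)
  \<comment> \<open>The negated claim is used at \<open>x = d k\<close> with
    \<open>c = 1 - d k\<close>, so both tolerances vanish together.\<close>
  have "\<exists>\<alpha>. t \<le> (\<Sum>i<n. \<bar>\<alpha> i\<bar>) \<and> 1 - d k < \<nu> (\<Sum>i<n. \<alpha> i *\<^sub>R p i) (ereal (d k))" for k
    using contr d[of k] by (metis diff_less_eq less_add_same_cancel1 not_le)
  then obtain \<alpha> where \<alpha>: "\<And>k. t \<le> (\<Sum>i<n. \<bar>\<alpha> k i\<bar>)"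
    "\<And>k. 1 - d k < \<nu> (\<Sum>i<n. \<alpha> k i *\<^sub>R p i) (ereal (d k))"
    by metis
  define N where "N k = (\<Sum>i<n. \<bar>\<alpha> k i\<bar>)" for k
  have N: "t \<le> N k" "0 < N k" for k using \<alpha>(1)[of k] t by (auto simp: N_def)
  \<comment> \<open>The factor \<open>t / N k\<close> is at most 1, so \<open>norm_contract\<close>
    keeps the lower bound \<open>1 - d k\<close>.\<close>
  define \<beta> where "\<beta> k i = t / N k * \<alpha> k i" for k i
  have sum\<beta>: "(\<Sum>i<n. \<bar>\<beta> k i\<bar>) = t" for k
  proof -
    have "(\<Sum>i<n. \<bar>\<beta> k i\<bar>) = t / N k * N k"
      using N(2)[of k] t unfolding N_def[of k] sum_distrib_left by (simp add: \<beta>_def abs_mult N_def)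
    then show ?thesis using N(2)[of k] by simp
  qed
  have "\<bar>\<beta> k i\<bar> \<le> t" if "i < n" for k i
    unfolding sum\<beta>[of k, symmetric] using that by (intro member_le_sum[where f = "\<lambda>i. \<bar>\<beta> k i\<bar>"]) auto
  then obtain r b where r: "strict_mono r" "\<And>i. i < n \<Longrightarrow> (\<lambda>k. \<beta> (r k) i) \<longlonglongrightarrow> b i"
    using bounded_coords_convergent_subseq[of n \<beta> t] by blast
  have "(\<lambda>k. \<Sum>i<n. \<bar>\<beta> (r k) i\<bar>) \<longlonglongrightarrow> (\<Sum>i<n. \<bar>b i\<bar>)"
    using r(2) by (intro tendsto_sum tendsto_rabs) auto
  then have "(\<Sum>i<n. \<bar>b i\<bar>) = t" by (simp add: sum\<beta> LIMSEQ_const_iff)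
  then have nz: "(\<Sum>i<n. b i *\<^sub>R p i) \<noteq> 0" (is "?q \<noteq> 0")
    using t by (intro independent_comb_nonzero[OF inj ind]) simp
  let ?c = "\<lambda>k. \<Sum>i<n. \<beta> k i *\<^sub>R p i"
  have c: "1 - d k < \<nu> (?c k) (ereal (d k))" for k
  proof -
    have "\<bar>t / N k\<bar> \<le> 1" using N[of k] t by simp
    from norm_contract[OF this, of "\<Sum>i<n. \<alpha> k i *\<^sub>R p i"] \<alpha>(2)[of k] show ?thesis
      by (simp add: df_le_def \<beta>_def scaleR_sum_right) (meson less_le_trans)
  qed
  have "weak_conv (\<lambda>k. \<nu> (?c k)) eps0"
  proof (subst weak_conv_eps0_iff, simp, intro allI impI)
    fix x :: real assume "0 < x"
    have "eventually (\<lambda>k. d k < x) sequentially" using d0 \<open>0 < x\<close> by (rule order_tendstoD)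
    then have lower: "eventually (\<lambda>k. 1 - d k \<le> \<nu> (?c k) (ereal x)) sequentially"
    proof eventually_elim
      case (elim k)
      then show ?case using c[of k] DeltaPlus_mono[OF in_DeltaPlus[of "?c k"], of "d k" x] by linarith
    qed
    have "(\<lambda>k. 1 - d k) \<longlonglongrightarrow> 1" using tendsto_diff[OF tendsto_const d0, of 1] by simp
    from real_tendsto_sandwich[OF lower _ this tendsto_const]
    show "(\<lambda>k. \<nu> (?c k) (ereal x)) \<longlonglongrightarrow> 1" by (simp add: DeltaPlusD)
  qed
  then have "weak_conv (\<lambda>k. \<nu> (?c (r k))) eps0" by (rule weak_conv_subseq[OF _ r(1)])
  moreover have "(\<lambda>k. b i - \<beta> (r k) i) \<longlonglongrightarrow> 0" if "i < n" for i
    using tendsto_diff[OF tendsto_const[of "b i"] r(2)[OF that]] by simp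
  then have "weak_conv (\<lambda>k. \<nu> (\<Sum>i<n. (b i - \<beta> (r k) i) *\<^sub>R p i)) eps0"
    by (rule norm_comb_tendsto_eps0)
  ultimately have "weak_conv (\<lambda>k. \<nu> (?c (r k) + (\<Sum>i<n. (b i - \<beta> (r k) i) *\<^sub>R p i))) eps0"
    by (rule norm_add_tendsto_eps0)
  moreover have "?c (r k) + (\<Sum>i<n. (b i - \<beta> (r k) i) *\<^sub>R p i) = ?q" for k
    by (simp add: algebra_simps flip: sum.distrib)
  ultimately have "weak_conv (\<lambda>k. \<nu> ?q) eps0" by simp
  then have "\<nu> ?q = eps0"
    using weak_conv_unique[OF in_DeltaPlus eps0_in_DeltaPlus weak_conv_const] by blast
  then show False using norm_eq_eps0 nz by simp
qed

end

section \<open>The dominating norm on the real line\<close>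

theorem theorem15:
  fixes \<nu> :: "'v::real_vector \<Rightarrow> df" and T Ts :: "df \<Rightarrow> df \<Rightarrow> df"
    and p :: "nat \<Rightarrow> 'v" and n :: nat
  assumes "PN_space \<nu> T Ts"
    and "archimedean_tf Ts"
    and "\<forall>q. \<nu> q \<noteq> epsInf"
    and "inj_on p {..<n}"
    and "independent (p ` {..<n})"
  shows "\<exists>c::real. c \<noteq> 0 \<and> (\<exists>(\<nu>'::real \<Rightarrow> df) T' Ts'. PN_space \<nu>' T' Ts'
           \<and> archimedean_tf Ts' \<and> (\<forall>q. \<nu>' q \<noteq> epsInf)
           \<and> (\<forall>\<alpha>::nat \<Rightarrow> real. df_le (\<nu> (\<Sum>i<n. \<alpha> i *\<^sub>R p i))
                                       (\<nu>' (c * (\<Sum>i<n. \<bar>\<alpha> i\<bar>)))))"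
proof -
  interpret archimedean_PN \<nu> T Ts using assms by unfold_locales auto
  \<comment> \<open>Inserting 0 keeps the set nonempty for \<open>n = 0\<close> and
    \<open>t > 0\<close>, where no coefficient vector qualifies, and makes the supremum
    nonnegative.\<close>
  define S where "S t x = insert 0 {\<nu> (\<Sum>i<n. \<alpha> i *\<^sub>R p i) (ereal x) | \<alpha>. t \<le> (\<Sum>i<n. \<bar>\<alpha> i\<bar>)}"
    for t x :: real
  define \<Phi> where "\<Phi> t x = Sup (S t x)" for t x
  have S_bdd: "bdd_above (S t x)" for t x
    by (rule bdd_aboveI[of _ 1]) (auto simp: S_def DeltaPlusD)
  have upper: "\<nu> (\<Sum>i<n. \<alpha> i *\<^sub>R p i) (ereal x) \<le> \<Phi> t x" if "t \<le> (\<Sum>i<n. \<bar>\<alpha> i\<bar>)" for \<alpha> t x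
    unfolding \<Phi>_def by (rule cSup_upper[OF _ S_bdd]) (use that in \<open>auto simp: S_def\<close>)
  have nonneg: "0 \<le> \<Phi> t x" for t x
    unfolding \<Phi>_def by (rule cSup_upper[OF _ S_bdd]) (simp add: S_def)
  have least: "\<Phi> t x \<le> c"
    if "0 \<le> c" "\<And>\<alpha>. t \<le> (\<Sum>i<n. \<bar>\<alpha> i\<bar>) \<Longrightarrow> \<nu> (\<Sum>i<n. \<alpha> i *\<^sub>R p i) (ereal x) \<le> c" for t x c
    unfolding \<Phi>_def by (rule cSup_least) (use that in \<open>auto simp: S_def\<close>)
  obtain \<theta> \<eta> where sc: "scale_change \<theta> \<eta>"
    and dom: "\<And>t x. 0 < t \<Longrightarrow> 0 < x \<Longrightarrow> \<Phi> t x \<le> \<theta> (exp (- max 0 (t - \<eta> x)))"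
  proof (rule dominating_scale_change[of \<Phi>])
    fix t x :: real
    show "0 \<le> \<Phi> t x" by (rule nonneg)
    show "\<Phi> t x \<le> 1" by (rule least) (auto simp: DeltaPlusD)
  next
    fix s t x :: real assume "s \<le> t"
    then show "\<Phi> t x \<le> \<Phi> s x" by (intro least nonneg upper) auto
  next
    fix t x y :: real assume "x \<le> y"
    then show "\<Phi> t x \<le> \<Phi> t y"
      by (intro least nonneg order_trans[OF DeltaPlus_mono[OF in_DeltaPlus] upper]) auto
  next
    fix x e :: real assume "0 < e"
    then show "\<exists>t>0. \<Phi> t x \<le> e"
      using norm_comb_vanishes_at_infinity[OF assms(4,5), of e x] least[of e] by (meson less_imp_le)
  next
    fix t :: real assume "0 < t"
    then obtain x c where xc: "0 < x" "c < 1"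
      "\<And>\<alpha>. t \<le> (\<Sum>i<n. \<bar>\<alpha> i\<bar>) \<Longrightarrow> \<nu> (\<Sum>i<n. \<alpha> i *\<^sub>R p i) (ereal x) \<le> c"
      using norm_comb_away_from_eps0[OF assms(4,5)] by blast
    have "\<Phi> t x \<le> max 0 c" by (rule least) (use xc(3) in \<open>auto intro: max.coboundedI2\<close>)
    then show "\<exists>x>0. \<Phi> t x < 1" using xc by (intro exI[of _ x]) auto
  qed blast
  interpret scale_change \<theta> \<eta> by (rule sc)
  let ?\<nu>' = "\<lambda>t. rescale \<theta> \<eta> (exp_norm t)"
  \<comment> \<open>The factor is 1, since all scaling is absorbed by \<open>\<theta>\<close> and
    \<open>\<eta>\<close>. A zero coefficient sum gives the greatest element \<open>eps0\<close> on
    the right; otherwise \<open>dom\<close> is applied with the coefficient sum itself as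
    \<open>t\<close>.\<close>
  have le: "df_le (\<nu> (\<Sum>i<n. \<alpha> i *\<^sub>R p i)) (?\<nu>' (1 * (\<Sum>i<n. \<bar>\<alpha> i\<bar>)))" for \<alpha>
  proof (cases "(\<Sum>i<n. \<bar>\<alpha> i\<bar>) = 0")
    case True
    then show ?thesis
      using exp_norm_eq_eps0_iff[of 0] by (simp add: df_le_eps0)
  next
    case False
    then have t: "0 < (\<Sum>i<n. \<bar>\<alpha> i\<bar>)" (is "0 < ?t") by (simp add: less_le sum_nonneg)
    show ?thesis
    proof (rule df_le_DeltaPlusI)
      fix x
      show "\<nu> (\<Sum>i<n. \<alpha> i *\<^sub>R p i) (ereal x) \<le> ?\<nu>' (1 * ?t) (ereal x)"
      proof (cases "0 < x")
        case True
        then have "0 < \<eta> x" using \<eta>_less[of 0 x] \<eta>(2) by simp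
        then show ?thesis
          using order_trans[OF upper[OF order_refl] dom[OF t True]] t
          by (simp add: exp_norm_ereal)
      next
        case False
        then show ?thesis using DeltaPlus_nonpos[OF in_DeltaPlus, of "ereal x"]
          DeltaPlusD(1)[OF rescale_in_DeltaPlus[OF exp_norm_in_DeltaPlus], of ?t "ereal x"]
          by simp
      qed
    qed simp_all
  qed
  have ne: "?\<nu>' t \<noteq> epsInf" for t
  proof
    interpret i: scale_change "inv \<theta>" "inv \<eta>" by (rule scale_change_inv)
    assume "?\<nu>' t = epsInf"
    then have "exp_norm t = epsInf"
      using rescale_inv(1)[of "exp_norm t"] i.rescale_epsInf by simp
    then show False by (simp add: exp_norm_neq_epsInf)
  qed
  have "PN_space ?\<nu>' (conj_tf sup_conv) (conj_tf sup_conv)"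
    by (rule PN_space_conj[OF PN_space_exp_norm])
  moreover have "archimedean_tf (conj_tf sup_conv)"
    by (rule archimedean_conj_tf[OF triangle_function_sup_conv archimedean_sup_conv])
  ultimately have "PN_space ?\<nu>' (conj_tf sup_conv) (conj_tf sup_conv) \<and> archimedean_tf (conj_tf sup_conv)
      \<and> (\<forall>q. ?\<nu>' q \<noteq> epsInf)
      \<and> (\<forall>\<alpha>. df_le (\<nu> (\<Sum>i<n. \<alpha> i *\<^sub>R p i)) (?\<nu>' (1 * (\<Sum>i<n. \<bar>\<alpha> i\<bar>))))"
    using ne le by (intro conjI allI)
  then show ?thesis
    by (intro exI[of _ "1 :: real"] conjI) (rule one_neq_zero, blast)
qed

end
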